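(* Let $(\varepsilon_n)_{n\ge1}$ be any sequence in $(0,1)$ such that $n\varepsilon_n\to\infty$. Then \[\mathbb{P}\big(Z_n(0)>0 \text{ and } Z_n(\varepsilon_n)>0\big)-\mathbb{P}\big(Z_n(0)>0\big)^2\to 0 \quad\text{as } n\to\infty.\]
   Context: Let $(X_j^i)_{j\ge 1,\,i\ge 0}$ be i.i.d. random variables with $\mathbb{P}(X_j^i=1)=\mathbb{P}(X_j^i=-1)=1/2$, and let $(N_j(t),t\ge0)_{j\ge1}$ be independent rate-$1$ Poisson processes, independent of the $X_j^i$. Define $X_j(t)=X_j^i$ whenever $N_j(t)=i$. The dynamical switch random walk is $Z_n(t)=\sum_{k=1}^n\prod_{j=1}^k X_j(t)$ for $n\ge 0$, $t\ge0$. *)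

theory Defs
  imports "HOL-Probability.Probability"
begin

definition poisson_process :: "'a measure \<Rightarrow> (real \<Rightarrow> 'a \<Rightarrow> nat) \<Rightarrow> bool" where
  "poisson_process M N \<longleftrightarrow>
     (\<forall>t\<ge>0. N t \<in> measurable M (count_space UNIV)) \<and>
     (\<forall>\<omega>\<in>space M. N 0 \<omega> = 0) \<and>
     (\<forall>s t. 0 \<le> s \<longrightarrow> s < t \<longrightarrow>
        distr M (count_space UNIV) (\<lambda>\<omega>. N t \<omega> - N s \<omega>) = measure_pmf (poisson_pmf (t - s))) \<and>
     (\<forall>(n::nat) (ts::nat \<Rightarrow> real). 0 \<le> ts 0 \<longrightarrow> (\<forall>i<n. ts i \<le> ts (Suc i)) \<longrightarrow>
        prob_space.indep_vars M (\<lambda>_. count_space UNIV)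
          (\<lambda>i \<omega>. N (ts (Suc i)) \<omega> - N (ts i) \<omega>) {..<n})"

definition dyn_X :: "(nat \<Rightarrow> nat \<Rightarrow> 'a \<Rightarrow> int) \<Rightarrow> (nat \<Rightarrow> real \<Rightarrow> 'a \<Rightarrow> nat) \<Rightarrow> nat \<Rightarrow> real \<Rightarrow> 'a \<Rightarrow> int" where
  "dyn_X X N j t \<omega> = X j (N j t \<omega>) \<omega>"

definition switch_walk :: "(nat \<Rightarrow> nat \<Rightarrow> 'a \<Rightarrow> int) \<Rightarrow> (nat \<Rightarrow> real \<Rightarrow> 'a \<Rightarrow> nat) \<Rightarrow> nat \<Rightarrow> real \<Rightarrow> 'a \<Rightarrow> int" where
  "switch_walk X N n t \<omega> = (\<Sum>k=1..n. \<Prod>j=1..k. dyn_X X N j t \<omega>)"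

end

theory Submission
  imports Defs
begin

text \<open>
  Put \<open>\<sigma>\<^sub>j = X\<^sub>j(0)\<close> and \<open>\<eta>\<^sub>j = X\<^sub>j(0) X\<^sub>j(\<epsilon>)\<close>. All these signs are independent, \<open>\<sigma>\<^sub>j\<close> is uniform
  and \<open>\<eta>\<^sub>j\<close> has mean \<open>\<rho> = e\<^sup>-\<^sup>\<epsilon>\<close>. The partial products \<open>x\<^sub>k\<close> of the \<open>\<sigma>\<^sub>j\<close> are again independent
  uniform signs, so with \<open>r\<^sub>k\<close> the partial products of the \<open>\<eta>\<^sub>j\<close> the two walks are \<open>\<Sum>x\<^sub>k\<close> and
  \<open>\<Sum>x\<^sub>k r\<^sub>k\<close> with \<open>x\<close> independent of \<open>r\<close>.

  For fixed \<open>r\<close>, the probability \<open>Q(r)\<close> that both sums are positive depends only on \<open>D = \<Sum>r\<^sub>k\<close>, and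
  \<open>Q(r) + Q(-r)\<close> is close to the probability \<open>p\<close> that the first one is. Flipping \<open>|D|\<close> of the signs
  \<open>r\<^sub>k\<close> turns \<open>D\<close> into \<open>-D\<close> and changes the second sum by a term of order \<open>|D|\<^sup>1\<^sup>/\<^sup>2\<close> (Chebyshev), whereas
  a sum of \<open>n\<close> signs lies in a given window of length \<open>K\<close> with probability \<open>O(K / n\<^sup>1\<^sup>/\<^sup>2)\<close> (central
  binomial coefficient). Hence \<open>Q(r)\<close> is close to \<open>p / 2\<close>, and thus to \<open>p\<^sup>2\<close>, once \<open>|D|\<close> is much
  smaller than \<open>n\<close>. This holds for most \<open>r\<close>, as \<open>E D\<^sup>2 = \<Sum>\<rho>\<^sup>|\<^sup>k\<^sup>-\<^sup>l\<^sup>| \<le> 2n / (1 - \<rho>)\<close> is at most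
  \<open>4n / \<epsilon>\<close>, which is \<open>o(n\<^sup>2)\<close>.
\<close>

subsection \<open>Uniform and biased sign vectors\<close>

text \<open>Extensional functions, so that the set is finite and two vectors agreeing on
  \<open>{1..n}\<close> are equal.\<close>

definition signs :: "nat \<Rightarrow> (nat \<Rightarrow> int) set" where
  "signs n = PiE {1..n} (\<lambda>_. {-1, 1})"

definition freq :: "nat \<Rightarrow> ((nat \<Rightarrow> int) \<Rightarrow> bool) \<Rightarrow> real" where
  "freq n P = (\<Sum>s\<in>signs n. of_bool (P s)) / 2 ^ n"

text \<open>The probability of \<open>s\<close> when the coordinates are independent signs of mean
  \<open>\<rho>\<close>; \<open>\<rho> = 0\<close> gives the uniform law.\<close>

definition bias_weight :: "real \<Rightarrow> nat \<Rightarrow> (nat \<Rightarrow> int) \<Rightarrow> real" where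
  "bias_weight \<rho> n s = (\<Prod>j=1..n. (1 + \<rho> * s j) / 2)"

text \<open>This is \<open>Q(r)\<close> of the outline. It depends on \<open>r\<close> through its
  values on \<open>{1..n}\<close>, so \<open>r\<close> need not be extensional.\<close>

definition joint_positive :: "nat \<Rightarrow> (nat \<Rightarrow> int) \<Rightarrow> real" where
  "joint_positive n r = freq n (\<lambda>s. 0 < (\<Sum>k=1..n. s k) \<and> 0 < (\<Sum>k=1..n. s k * r k))"

lemma finite_signs [simp]: "finite (signs n)"
  by (simp add: signs_def finite_PiE)

lemma signsD: "s \<in> signs n \<Longrightarrow> j \<in> {1..n} \<Longrightarrow> s j = -1 \<or> s j = 1"
  by (auto simp: signs_def)

lemma signs_square: "s \<in> signs n \<Longrightarrow> j \<in> {1..n} \<Longrightarrow> s j * s j = 1"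
  using signsD by fastforce

lemma signs_eqI:
  "\<lbrakk>s \<in> signs n; t \<in> signs n; \<And>j. j \<in> {1..n} \<Longrightarrow> s j = t j\<rbrakk> \<Longrightarrow> s = t"
  unfolding signs_def by (rule PiE_ext)

lemma signsI: "(\<And>j. j \<in> {1..n} \<Longrightarrow> f j = -1 \<or> f j = 1) \<Longrightarrow> (\<lambda>j\<in>{1..n}. f j) \<in> signs n"
  unfolding signs_def by (simp add: PiE_iff)

lemma freq_mono: "(\<And>s. s \<in> signs n \<Longrightarrow> P s \<Longrightarrow> Q s) \<Longrightarrow> freq n P \<le> freq n Q"
  unfolding freq_def by (intro divide_right_mono sum_mono) auto

lemma freq_cong: "(\<And>s. s \<in> signs n \<Longrightarrow> P s \<longleftrightarrow> Q s) \<Longrightarrow> freq n P = freq n Q"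
  by (intro antisym freq_mono) auto

lemma freq_le_add:
  "(\<And>s. s \<in> signs n \<Longrightarrow> P s \<Longrightarrow> Q s \<or> R s) \<Longrightarrow> freq n P \<le> freq n Q + freq n R"
  unfolding freq_def add_divide_distrib [symmetric] sum.distrib [symmetric]
  by (intro divide_right_mono sum_mono) auto

lemma freq_add:
  "(\<And>s. s \<in> signs n \<Longrightarrow> \<not> (P s \<and> Q s)) \<Longrightarrow> freq n P + freq n Q = freq n (\<lambda>s. P s \<or> Q s)"
  unfolding freq_def add_divide_distrib [symmetric] sum.distrib [symmetric]
  by (intro arg_cong2 [where f = "(/)"] sum.cong) auto

lemma freq_nonneg: "0 \<le> freq n P"
  unfolding freq_def by (intro divide_nonneg_nonneg sum_nonneg) auto

lemma freq_True: "freq n (\<lambda>_. True) = 1"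
  by (simp add: freq_def signs_def card_PiE)

lemma freq_le_1: "freq n P \<le> 1"
  using freq_mono [of n P "\<lambda>_. True"] freq_True by simp

lemma freq_bij:
  assumes "bij_betw h (signs n) (signs n)"
  shows "freq n (\<lambda>s. P (h s)) = freq n P"
  unfolding freq_def using sum.reindex_bij_betw [OF assms, of "\<lambda>s. of_bool (P s) :: real"]
  by (simp only:)

lemma freq_eq_card: "freq n P = card {s \<in> signs n. P s} / 2 ^ n"
  by (simp add: freq_def sum.If_cases of_bool_def Int_def)

section \<open>Bijections of the sign vectors, which preserve the uniform law\<close>

lemma bij_betw_signsI:
  assumes "\<And>s. s \<in> signs n \<Longrightarrow> h s \<in> signs n" "inj_on h (signs n)"
  shows "bij_betw h (signs n) (signs n)"
  by (metis assms bij_betw_def endo_inj_surj finite_signs image_subsetI)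

text \<open>Used twice: to remove fixed signs from an inner product, and to pass from a pair of sign
  vectors to one vector and the pointwise ratio.\<close>

lemma bij_betw_signs_mult:
  assumes r: "r \<in> signs n"
  shows "bij_betw (\<lambda>s. \<lambda>j\<in>{1..n}. s j * r j) (signs n) (signs n)"
proof (rule bij_betw_signsI)
  fix s assume s: "s \<in> signs n"
  show "(\<lambda>j\<in>{1..n}. s j * r j) \<in> signs n"
  proof (rule signsI)
    fix j assume j: "j \<in> {1..n}"
    show "s j * r j = -1 \<or> s j * r j = 1"
      using signsD [OF s j] signsD [OF r j] by auto
  qed
next
  show "inj_on (\<lambda>s. \<lambda>j\<in>{1..n}. s j * r j) (signs n)"
  proof (rule inj_onI)
    fix s t assume st: "s \<in> signs n" "t \<in> signs n"
      and eq: "(\<lambda>j\<in>{1..n}. s j * r j) = (\<lambda>j\<in>{1..n}. t j * r j)"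
    show "s = t"
    proof (rule signs_eqI [OF st])
      fix j assume j: "j \<in> {1..n}"
      have "s j * r j = t j * r j" using fun_cong [OF eq, of j] by (simp only: restrict_apply' [OF j])
      then show "s j = t j" using signsD [OF r j] by auto
    qed
  qed
qed

lemma bij_betw_signs_permute:
  assumes p: "bij_betw p {1..n} {1..n}"
  shows "bij_betw (\<lambda>s. \<lambda>j\<in>{1..n}. s (p j)) (signs n) (signs n)"
proof (rule bij_betw_signsI)
  fix s assume s: "s \<in> signs n"
  show "(\<lambda>j\<in>{1..n}. s (p j)) \<in> signs n"
    by (intro signsI signsD [OF s]) (use bij_betwE [OF p] in blast)
next
  show "inj_on (\<lambda>s. \<lambda>j\<in>{1..n}. s (p j)) (signs n)"
  proof (rule inj_onI)
    fix s t assume st: "s \<in> signs n" "t \<in> signs n"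
      and eq: "(\<lambda>j\<in>{1..n}. s (p j)) = (\<lambda>j\<in>{1..n}. t (p j))"
    show "s = t"
    proof (rule signs_eqI [OF st])
      fix j assume j: "j \<in> {1..n}"
      then have "j \<in> p ` {1..n}" using bij_betw_imp_surj_on [OF p] by simp
      then obtain i where i: "i \<in> {1..n}" "p i = j" by blast
      show "s j = t j" using fun_cong [OF eq, of i] by (simp only: restrict_apply' [OF i(1)] i(2))
    qed
  qed
qed

text \<open>Each sign is recovered as the ratio of consecutive partial products. Hence the steps of
  the walk are again independent uniform signs.\<close>

lemma bij_betw_signs_cumprod:
  "bij_betw (\<lambda>s. \<lambda>k\<in>{1..n}. \<Prod>j=1..k. s j) (signs n) (signs n)"
proof (rule bij_betw_signsI)
  fix s assume s: "s \<in> signs n"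
  have "(\<Prod>j=1..k. s j) = -1 \<or> (\<Prod>j=1..k. s j) = 1" if "k \<le> n" for k
    using that
  proof (induction k)
    case (Suc k)
    then show ?case using signsD [OF s, of "Suc k"] by auto
  qed simp
  then show "(\<lambda>k\<in>{1..n}. \<Prod>j=1..k. s j) \<in> signs n"
    by (intro signsI) auto
next
  show "inj_on (\<lambda>s. \<lambda>k\<in>{1..n}. \<Prod>j=1..k. s j) (signs n)"
  proof (rule inj_onI)
    fix s t assume st: "s \<in> signs n" "t \<in> signs n"
      and eq: "(\<lambda>k\<in>{1..n}. \<Prod>j=1..k. s j) = (\<lambda>k\<in>{1..n}. \<Prod>j=1..k. t j)"
    have eq': "(\<Prod>j=1..k. s j) = (\<Prod>j=1..k. t j)" if "k \<le> n" for k
    proof (cases "k = 0")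
      case False
      then have k: "k \<in> {1..n}" using that by simp
      show ?thesis using fun_cong [OF eq, of k] by (simp only: restrict_apply' [OF k])
    qed simp
    show "s = t"
    proof (rule signs_eqI [OF st])
      fix j assume j: "j \<in> {1..n}"
      then obtain i where i: "j = Suc i" by (cases j) auto
      have "(\<Prod>j=1..i. s j) * s j = (\<Prod>j=1..i. s j) * t j"
        using eq' [of j] eq' [of i] j i by simp
      moreover have "(\<Prod>j=1..i. s j) \<noteq> 0"
      proof (subst prod_zero_iff)
        show "\<not> (\<exists>a\<in>{1..i}. s a = 0)"
        proof safe
          fix a assume "a \<in> {1..i}" "s a = 0"
          then show False using signsD [OF st(1), of a] j i by simp
        qed
      qed simp
      ultimately show "s j = t j" by simp
    qed
  qed
qed

text \<open>By independence the sum factors over coordinates: those in \<open>J\<close> contribute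
  their mean \<open>\<rho>\<close>, the others their total mass 1. The case \<open>J = {}\<close>
  gives the total mass, and \<open>\<rho> = 0\<close> gives orthogonality of uniform signs.\<close>

lemma sum_bias_weight_prod:
  assumes "J \<subseteq> {1..n}"
  shows "(\<Sum>s\<in>signs n. bias_weight \<rho> n s * (\<Prod>j\<in>J. real_of_int (s j))) = \<rho> ^ card J"
proof -
  have "(\<Sum>s\<in>signs n. bias_weight \<rho> n s * (\<Prod>j\<in>J. real_of_int (s j)))
      = (\<Sum>s\<in>signs n. \<Prod>j=1..n. (1 + \<rho> * s j) / 2 * (if j \<in> J then s j else 1))"
    unfolding bias_weight_def prod.distrib of_int_prod [symmetric]
    using assms by (simp add: prod.If_cases Int_absorb1 if_distrib [of real_of_int])
  also have "\<dots> = (\<Prod>j=1..n. \<Sum>x\<in>{-1, 1::int}. (1 + \<rho> * x) / 2 * (if j \<in> J then x else 1))"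
    unfolding signs_def by (subst prod_sum_PiE) auto
  also have "\<dots> = (\<Prod>j=1..n. if j \<in> J then \<rho> else 1)"
    by (intro prod.cong) (auto simp: field_simps)
  also have "\<dots> = \<rho> ^ card J"
    using assms by (simp add: prod.If_cases Int_absorb1)
  finally show ?thesis .
qed

lemma sum_bias_weight: "(\<Sum>s\<in>signs n. bias_weight \<rho> n s) = 1"
  using sum_bias_weight_prod [of "{}" n \<rho>] by simp

lemma bias_weight_nonneg:
  assumes "0 \<le> \<rho>" "\<rho> \<le> 1" "s \<in> signs n"
  shows "0 \<le> bias_weight \<rho> n s"
  unfolding bias_weight_def
proof (intro prod_nonneg ballI)
  fix j assume "j \<in> {1..n}"
  then show "0 \<le> (1 + \<rho> * s j) / 2" using assms signsD [OF assms(3), of j] by auto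
qed

section \<open>Anticoncentration for sums of uniform signs\<close>

text \<open>The squared form of the bound \<open>4 ^ m / sqrt (2 * m + 1)\<close>. The induction
  rests on the ratio \<open>2 * (2 * m + 1) / (m + 1)\<close> of consecutive coefficients and on
  (2m+1)(2m+3) \<le> 4(m+1)^2.\<close>

lemma central_binomial_square_bound:
  "((2 * m) choose m)\<^sup>2 * (2 * m + 1) \<le> (16::nat) ^ m"
proof (induction m)
  case (Suc m)
  let ?c = "(2 * m) choose m" and ?d = "(2 * Suc m) choose Suc m"
  have rec: "(m + 1) * ?d = 2 * (2 * m + 1) * ?c"
  proof -
    have "Suc m * ?d = 2 * Suc m * (Suc (2 * m) choose m)"
      using Suc_times_binomial_eq [of "Suc (2 * m)" m] by (simp add: mult_ac)
    moreover have "Suc (2 * m) choose m = Suc (2 * m) choose Suc m"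
      using binomial_symmetric [of m "Suc (2 * m)"] by simp
    moreover have "Suc m * (Suc (2 * m) choose Suc m) = Suc (2 * m) * ?c"
      using Suc_times_binomial_eq [of "2 * m" m] by (simp add: mult_ac)
    ultimately have "Suc m * ?d = 2 * (Suc (2 * m) * ?c)" by (metis mult.assoc)
    then show ?thesis by simp
  qed
  \<comment> \<open>The factor \<open>(m + 1)\<^sup>2\<close> clears the denominator of the
    recurrence and is cancelled at the end.\<close>
  have "(m + 1)\<^sup>2 * (?d\<^sup>2 * (2 * Suc m + 1)) = ((m + 1) * ?d)\<^sup>2 * (2 * m + 3)"
  proof -
    have "2 * Suc m + 1 = 2 * m + 3" by simp
    then show ?thesis by (simp only: power_mult_distrib mult.assoc)
  qed
  also have "\<dots> = 4 * ((2 * m + 1) * (2 * m + 3)) * (?c\<^sup>2 * (2 * m + 1))"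
    unfolding rec by (simp add: power2_eq_square algebra_simps)
  also have "\<dots> \<le> 4 * (4 * (m + 1)\<^sup>2) * 16 ^ m"
  proof (rule mult_le_mono [OF _ Suc.IH])
    show "4 * ((2 * m + 1) * (2 * m + 3)) \<le> 4 * (4 * (m + 1)\<^sup>2)"
      by (simp add: power2_eq_square algebra_simps)
  qed
  also have "\<dots> = (m + 1)\<^sup>2 * 16 ^ Suc m" by simp
  finally have "(m + 1)\<^sup>2 * (?d\<^sup>2 * (2 * Suc m + 1)) \<le> (m + 1)\<^sup>2 * 16 ^ Suc m" .
  moreover have "0 < (m + 1)\<^sup>2" by simp
  ultimately show ?case by (rule Nat.mult_le_cancel1 [THEN iffD1, THEN mp])
qed simp

lemma binomial_le_sqrt: "real (n choose k) \<le> 2 ^ n / sqrt (real n + 1)"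
proof -
  have "(n choose (n div 2))\<^sup>2 * (n + 1) \<le> 4 ^ n"
  proof (cases "even n")
    case True
    then obtain m where m: "n = 2 * m" by blast
    then show ?thesis using central_binomial_square_bound [of m] by (simp add: power_mult)
  next
    \<comment> \<open>For odd \<open>n = 2 * m + 1\<close> the middle coefficient is half of the
      next central one.\<close>
    case False
    then obtain m where m: "n = 2 * m + 1" using oddE by blast
    have "Suc (2 * m) choose m = Suc (2 * m) choose Suc m"
      using binomial_symmetric [of m "Suc (2 * m)"] by simp
    then have "(2 * Suc m) choose Suc m = 2 * (n choose m)" using m by simp
    then have "(2 * (n choose m))\<^sup>2 * (2 * m + 3) \<le> 16 ^ Suc m"
      using central_binomial_square_bound [of "Suc m"] by (simp add: algebra_simps)
    moreover have "(16::nat) ^ Suc m = 4 * 4 ^ n" using m by (simp add: power_mult)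
    ultimately have "4 * ((n choose m)\<^sup>2 * (2 * m + 3)) \<le> 4 * 4 ^ n"
      by (simp add: power_mult_distrib)
    moreover have "(n choose m)\<^sup>2 * (n + 1) \<le> (n choose m)\<^sup>2 * (2 * m + 3)"
      using m by (intro mult_left_mono) auto
    ultimately have "(n choose m)\<^sup>2 * (n + 1) \<le> 4 ^ n" by linarith
    then show ?thesis using m by simp
  qed
  then have "(n choose k)\<^sup>2 * (n + 1) \<le> 4 ^ n"
    using binomial_maximum [of n k]
    by (meson mult_le_mono1 order_trans power_mono zero_le)
  then have "real ((n choose k)\<^sup>2 * (n + 1)) \<le> real (4 ^ n)" by (simp only: of_nat_le_iff)
  moreover have "((2::real) ^ n)\<^sup>2 = 4 ^ n"
    by (simp add: power2_eq_square flip: power_mult_distrib)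
  ultimately have "(real (n choose k) * sqrt (real n + 1))\<^sup>2 \<le> (2 ^ n)\<^sup>2"
    by (simp add: power_mult_distrib algebra_simps)
  then have "real (n choose k) * sqrt (real n + 1) \<le> 2 ^ n"
    using power2_le_imp_le by fastforce
  then show ?thesis by (simp add: field_simps)
qed

lemma sum_signs_eq_card:
  assumes "s \<in> signs n"
  shows "(\<Sum>k=1..n. s k) = 2 * int (card {j \<in> {1..n}. s j = 1}) - int n"
proof -
  have "(\<Sum>k=1..n. s k) = (\<Sum>k=1..n. 2 * of_bool (s k = 1) - 1)"
    using signsD [OF assms] by (intro sum.cong) fastforce+
  also have "\<dots> = 2 * int (card {j \<in> {1..n}. s j = 1}) - int n"
    by (simp add: sum_subtractf sum_distrib_left [symmetric] of_bool_def sum.If_cases Int_def)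
  finally show ?thesis .
qed

text \<open>A sign vector is determined by its set of ones, and the value of the sum fixes the size
  of that set.\<close>

lemma freq_sum_eq_le: "freq n (\<lambda>s. (\<Sum>k=1..n. s k) = x) \<le> 1 / sqrt (real n + 1)"
proof -
  let ?S = "{s \<in> signs n. (\<Sum>k=1..n. s k) = x}"
  define h where "h = (\<lambda>s::nat \<Rightarrow> int. {j \<in> {1..n}. s j = 1})"
  \<comment> \<open>If \<open>x\<close> is attained, \<open>x + int n\<close> is twice the number of
    ones and the division is exact; otherwise \<open>?S\<close> is empty and any value
    serves.\<close>
  define m where "m = nat ((x + int n) div 2)"
  have "card ?S \<le> card {B. B \<subseteq> {1..n} \<and> card B = m}"
  proof (rule card_inj_on_le)
    show "inj_on h ?S"
    proof (rule inj_onI)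
      fix s t assume st: "s \<in> ?S" "t \<in> ?S" "h s = h t"
      then have st': "s \<in> signs n" "t \<in> signs n" by auto
      show "s = t"
      proof (rule signs_eqI [OF st'])
        fix j assume j: "j \<in> {1..n}"
        have "s j = 1 \<longleftrightarrow> t j = 1" using st(3) j unfolding h_def by blast
        then show "s j = t j" using signsD [OF st'(1) j] signsD [OF st'(2) j] by auto
      qed
    qed
    show "h ` ?S \<subseteq> {B. B \<subseteq> {1..n} \<and> card B = m}"
    proof safe
      fix s assume "s \<in> signs n" "x = (\<Sum>k=1..n. s k)"
      then show "card (h s) = m" using sum_signs_eq_card unfolding m_def h_def by simp
    qed (auto simp: h_def)
  qed simp
  also have "\<dots> = n choose m" by (simp add: n_subsets)
  finally have "real (card ?S) \<le> 2 ^ n / sqrt (real n + 1)"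
    using binomial_le_sqrt [of n m] by linarith
  then show ?thesis by (simp add: freq_eq_card field_simps)
qed

lemma freq_inner_cong:
  assumes r: "r \<in> signs n"
  shows "freq n (\<lambda>s. P (\<Sum>k=1..n. s k * r k)) = freq n (\<lambda>s. P (\<Sum>k=1..n. s k))"
  using freq_bij [OF bij_betw_signs_mult [OF r], of "\<lambda>s. P (\<Sum>k=1..n. s k)"] by simp

lemma freq_inner_le:
  fixes K :: nat
  assumes r: "r \<in> signs n"
  shows "freq n (\<lambda>s. \<bar>\<Sum>k=1..n. s k * r k\<bar> \<le> int K) \<le> (2 * real K + 1) / sqrt (real n + 1)"
proof -
  \<comment> \<open>The window contains \<open>2 * K + 1\<close> integers, and each vector is
    counted at the one value that its sum takes.\<close>
  have "freq n (\<lambda>s. \<bar>\<Sum>k=1..n. s k\<bar> \<le> int K)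
      = (\<Sum>x\<in>{-int K..int K}. freq n (\<lambda>s. (\<Sum>k=1..n. s k) = x))"
    unfolding freq_def sum_divide_distrib [symmetric]
    by (subst sum.swap, intro arg_cong2 [where f = "(/)"] sum.cong refl) (auto simp: of_bool_def)
  also have "\<dots> \<le> (\<Sum>x\<in>{-int K..int K}. 1 / sqrt (real n + 1))"
    by (intro sum_mono freq_sum_eq_le)
  also have "\<dots> = (2 * real K + 1) / sqrt (real n + 1)" by simp
  finally show ?thesis using freq_inner_cong [OF r, of "\<lambda>y. \<bar>y\<bar> \<le> int K"] by simp
qed

section \<open>Chebyshev bound for partial sums\<close>

lemma sum_signs_mult:
  assumes "i \<in> {1..n}" "j \<in> {1..n}"
  shows "(\<Sum>s\<in>signs n. s i * s j) = (if i = j then 2 ^ n else 0)"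
proof (cases "i = j")
  case True
  then have "(\<Sum>s\<in>signs n. s i * s j) = (\<Sum>s\<in>signs n. 1)"
    using assms by (intro sum.cong) (auto simp: signs_square)
  then show ?thesis using True by (simp add: signs_def card_PiE)
next
  case False
  \<comment> \<open>The uniform law has bias 0, so for distinct indices the mixed moment is
    \<open>0 ^ 2\<close>.\<close>
  have "bias_weight 0 n s = 1 / 2 ^ n" for s by (simp add: bias_weight_def power_one_over)
  then have "(\<Sum>s\<in>signs n. real_of_int (s i) * real_of_int (s j)) / 2 ^ n = 0"
    using sum_bias_weight_prod [of "{i, j}" n 0] assms False by (simp add: sum_divide_distrib)
  then have "real_of_int (\<Sum>s\<in>signs n. s i * s j) = 0" by simp
  then have "(\<Sum>s\<in>signs n. s i * s j) = 0" by (simp only: of_int_eq_0_iff)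
  then show ?thesis using False by simp
qed

text \<open>Chebyshev's inequality: by orthogonality the second moment of the sum over
  \<open>T\<close> is \<open>card T\<close>.\<close>

lemma freq_partial_sum_gt:
  fixes K :: nat
  assumes T: "T \<subseteq> {1..n}" and "K > 0"
  shows "freq n (\<lambda>s. int K < \<bar>\<Sum>k\<in>T. s k\<bar>) \<le> real (card T) / (real K)\<^sup>2"
proof -
  have fin: "finite T" using T finite_subset by blast
  have "(\<Sum>s\<in>signs n. (int K)\<^sup>2 * of_bool (int K < \<bar>\<Sum>k\<in>T. s k\<bar>)) \<le> (\<Sum>s\<in>signs n. (\<Sum>k\<in>T. s k)\<^sup>2)"
  proof (rule sum_mono)
    fix s
    have "(int K)\<^sup>2 \<le> y\<^sup>2" if "int K < \<bar>y\<bar>" for y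
      using power_mono [of "int K" "\<bar>y\<bar>" 2] that by simp
    then show "(int K)\<^sup>2 * of_bool (int K < \<bar>\<Sum>k\<in>T. s k\<bar>) \<le> (\<Sum>k\<in>T. s k)\<^sup>2"
      by simp
  qed
  also have "(\<Sum>s\<in>signs n. (\<Sum>k\<in>T. s k)\<^sup>2) = (\<Sum>i\<in>T. \<Sum>j\<in>T. \<Sum>s\<in>signs n. s i * s j)"
    unfolding power2_eq_square sum_product
    by (subst sum.swap, intro sum.cong refl, subst sum.swap) simp
  also have "\<dots> = (\<Sum>i\<in>T. \<Sum>j\<in>T. if i = j then 2 ^ n else 0)"
    using T by (intro sum.cong refl sum_signs_mult) auto
  also have "\<dots> = int (card T) * 2 ^ n" using fin by simp
  finally have "(int K)\<^sup>2 * (\<Sum>s\<in>signs n. of_bool (int K < \<bar>\<Sum>k\<in>T. s k\<bar>)) \<le> int (card T) * 2 ^ n"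
    by (simp only: sum_distrib_left)
  then have "real_of_int ((int K)\<^sup>2 * (\<Sum>s\<in>signs n. of_bool (int K < \<bar>\<Sum>k\<in>T. s k\<bar>)))
      \<le> real_of_int (int (card T) * 2 ^ n)" by (simp only: of_int_le_iff)
  then have "(real K)\<^sup>2 * (\<Sum>s\<in>signs n. of_bool (int K < \<bar>\<Sum>k\<in>T. s k\<bar>)) \<le> real (card T) * 2 ^ n"
    by simp
  then show ?thesis using \<open>K > 0\<close> by (simp add: freq_def field_simps)
qed

subsection \<open>Joint positivity of two signed sums\<close>

text \<open>Equal sums mean equally many ones, so ones can be matched with ones and minus ones with
  minus ones.\<close>

lemma signs_sum_eq_permute:
  assumes r: "r \<in> signs n" and t: "t \<in> signs n" and eq: "(\<Sum>k=1..n. r k) = (\<Sum>k=1..n. t k)"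
  obtains p where "bij_betw p {1..n} {1..n}" "\<And>j. j \<in> {1..n} \<Longrightarrow> r (p j) = t j"
proof -
  define P where "P s = {j \<in> {1..n}. s j = 1}" for s :: "nat \<Rightarrow> int"
  have fin: "finite (P s)" "P s \<subseteq> {1..n}" for s by (auto simp: P_def)
  have card: "card (P t) = card (P r)"
    using eq sum_signs_eq_card [OF r] sum_signs_eq_card [OF t] by (simp add: P_def)
  obtain f where f: "bij_betw f (P t) (P r)"
    using finite_same_card_bij [OF fin(1) fin(1) card] by auto
  have "card ({1..n} - P t) = card ({1..n} - P r)"
    using card fin by (simp add: card_Diff_subset)
  then obtain g where g: "bij_betw g ({1..n} - P t) ({1..n} - P r)"
    using finite_same_card_bij [of "{1..n} - P t" "{1..n} - P r"] by auto
  define p where "p j = (if j \<in> P t then f j else g j)" for j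
  have "bij_betw p (P t \<union> ({1..n} - P t)) (P r \<union> ({1..n} - P r))"
  proof (rule bij_betw_combine)
    show "bij_betw p (P t) (P r)" using f by (subst bij_betw_cong [of _ _ f]) (auto simp: p_def)
    show "bij_betw p ({1..n} - P t) ({1..n} - P r)"
      using g by (subst bij_betw_cong [of _ _ g]) (auto simp: p_def)
  qed auto
  moreover have "P s \<union> ({1..n} - P s) = {1..n}" for s using fin(2) [of s] by blast
  ultimately have bij: "bij_betw p {1..n} {1..n}" by simp
  moreover have "r (p j) = t j" if j: "j \<in> {1..n}" for j
  proof (cases "j \<in> P t")
    case True
    then have "p j \<in> P r" using bij_betwE [OF f] by (simp add: p_def)
    then show ?thesis using True by (simp add: P_def)
  next
    case False
    then have "p j \<in> {1..n} - P r" using bij_betwE [OF g] j by (simp add: p_def)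
    then have "r (p j) = -1" using signsD [OF r, of "p j"] by (auto simp: P_def)
    moreover have "t j = -1" using False signsD [OF t j] j by (auto simp: P_def)
    ultimately show ?thesis by simp
  qed
  ultimately show thesis by (rule that)
qed

lemma joint_positive_cong:
  assumes "\<And>j. j \<in> {1..n} \<Longrightarrow> r j = t j"
  shows "joint_positive n r = joint_positive n t"
proof -
  have "(\<Sum>k=1..n. s k * r k) = (\<Sum>k=1..n. s k * t k)" for s :: "nat \<Rightarrow> int"
    by (intro sum.cong refl) (simp only: assms)
  then show ?thesis by (simp only: joint_positive_def)
qed

text \<open>Exchangeability: permuting the coordinates of the uniform vector preserves its law and
  its sum, and carries one inner product to the other.\<close>

lemma joint_positive_sum_eq:
  assumes r: "r \<in> signs n" and t: "t \<in> signs n" and eq: "(\<Sum>k=1..n. r k) = (\<Sum>k=1..n. t k)"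
  shows "joint_positive n r = joint_positive n t"
proof -
  obtain p where p: "bij_betw p {1..n} {1..n}" and rp: "\<And>j. j \<in> {1..n} \<Longrightarrow> r (p j) = t j"
    using signs_sum_eq_permute [OF assms] by blast
  let ?h = "\<lambda>s. \<lambda>j\<in>{1..n}. s (p j) :: int"
  have 1: "(\<Sum>k=1..n. ?h s k) = (\<Sum>k=1..n. s k)" for s
    using sum.reindex_bij_betw [OF p, of s] by simp
  have 2: "(\<Sum>k=1..n. ?h s k * t k) = (\<Sum>k=1..n. s k * r k)" for s
    using sum.reindex_bij_betw [OF p, of "\<lambda>k. s k * r k"] rp by simp
  show ?thesis
    using freq_bij [OF bij_betw_signs_permute [OF p],
        of "\<lambda>s. 0 < (\<Sum>k=1..n. s k) \<and> 0 < (\<Sum>k=1..n. s k * t k)"]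
    unfolding 1 2 joint_positive_def .
qed

text \<open>The two second sums differ by twice a sum over \<open>T\<close>, so their signs can only disagree if
  the first is at most \<open>2K\<close> or the sum over \<open>T\<close> exceeds \<open>K\<close> in absolute value.\<close>

lemma joint_positive_flip:
  fixes K :: nat
  assumes r: "r \<in> signs n" and T: "T \<subseteq> {1..n}" and rT: "\<And>j. j \<in> T \<Longrightarrow> r j = 1" and K: "K > 0"
  defines "r' \<equiv> \<lambda>j. if j \<in> T then -1 else r j"
  shows "\<bar>joint_positive n r - joint_positive n r'\<bar>
           \<le> (4 * real K + 1) / sqrt (real n + 1) + card T / (real K)\<^sup>2"
proof -
  have r's: "(\<Sum>k=1..n. s k * r' k) = (\<Sum>k=1..n. s k * r k) - 2 * (\<Sum>k\<in>T. s k)" for s :: "nat \<Rightarrow> int"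
  proof -
    have "(\<Sum>k=1..n. s k * r' k) = (\<Sum>k=1..n. s k * r k - (if k \<in> T then 2 * s k else 0))"
      by (intro sum.cong) (auto simp: r'_def rT)
    also have "\<dots> = (\<Sum>k=1..n. s k * r k) - (\<Sum>k\<in>T. 2 * s k)"
      using T by (simp add: sum_subtractf sum.If_cases Int_absorb1)
    finally show ?thesis by (simp add: sum_distrib_left)
  qed
  let ?c = "freq n (\<lambda>s. \<bar>\<Sum>k=1..n. s k * r k\<bar> \<le> int (2 * K))"
  let ?d = "freq n (\<lambda>s. int K < \<bar>\<Sum>k\<in>T. s k\<bar>)"
  let ?D = "\<lambda>s. \<bar>\<Sum>k=1..n. s k * r k\<bar> \<le> int (2 * K) \<or> int K < \<bar>\<Sum>k\<in>T. s k\<bar>"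
  have D: "freq n ?D \<le> ?c + ?d" by (rule freq_le_add)
  have "joint_positive n r \<le> joint_positive n r' + freq n ?D"
    unfolding joint_positive_def r's by (rule freq_le_add) auto
  moreover have "joint_positive n r' \<le> joint_positive n r + freq n ?D"
    unfolding joint_positive_def r's by (rule freq_le_add) auto
  moreover have "?c \<le> (4 * real K + 1) / sqrt (real n + 1)"
    using freq_inner_le [OF r, of "2 * K"] by simp
  moreover have "?d \<le> card T / (real K)\<^sup>2"
    by (rule freq_partial_sum_gt [OF T K])
  ultimately show ?thesis using D by linarith
qed

text \<open>Going from \<open>r\<close> to its negative directly would flip all \<open>n\<close>
  signs. Flipping only |D| of them already reaches the sum -D, and
  \<open>joint_positive_sum_eq\<close> says that only this sum matters.\<close>

lemma joint_positive_uminus_diff: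
  fixes K :: nat
  assumes r: "r \<in> signs n" and K: "K > 0"
  shows "\<bar>joint_positive n r - joint_positive n (\<lambda>j. - r j)\<bar>
           \<le> (4 * real K + 1) / sqrt (real n + 1) + \<bar>real_of_int (\<Sum>k=1..n. r k)\<bar> / (real K)\<^sup>2"
proof -
  have pos: "\<bar>joint_positive n r - joint_positive n (\<lambda>j. - r j)\<bar>
           \<le> (4 * real K + 1) / sqrt (real n + 1) + real_of_int (\<Sum>k=1..n. r k) / (real K)\<^sup>2"
    if r: "r \<in> signs n" and D: "0 \<le> (\<Sum>k=1..n. r k)" for r
  proof -
    let ?P = "{j \<in> {1..n}. r j = 1}"
    define d where "d = nat (\<Sum>k=1..n. r k)"
    have d: "(\<Sum>k=1..n. r k) = int d" using D by (simp add: d_def)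
    have "?P \<subseteq> {1..n}" by auto
    from card_mono [OF _ this] have "card ?P \<le> n" by simp
    \<comment> \<open>\<open>d\<close> is the number of ones minus the number of minus ones, so
      there are enough ones to flip.\<close>
    then have "d \<le> card ?P" using sum_signs_eq_card [OF r] d by linarith
    then obtain T where T: "T \<subseteq> ?P" "card T = d" by (metis obtain_subset_with_card_n)
    then have T': "T \<subseteq> {1..n}" "\<And>j. j \<in> T \<Longrightarrow> r j = 1" by auto
    define r' where "r' = (\<lambda>j\<in>{1..n}. if j \<in> T then -1 else r j)"
    define t where "t = (\<lambda>j\<in>{1..n}. - r j)"
    have r': "r' \<in> signs n" unfolding r'_def using signsD [OF r] by (intro signsI) auto
    have t: "t \<in> signs n" unfolding t_def using signsD [OF r] by (intro signsI) auto
    have "(\<Sum>k=1..n. r' k) = (\<Sum>k=1..n. r k - (if k \<in> T then 2 else 0))"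
      by (intro sum.cong) (auto simp: r'_def T')
    also have "\<dots> = (\<Sum>k=1..n. t k)"
      using T' T(2) d by (simp add: sum_subtractf sum.If_cases Int_absorb1 t_def sum_negf)
    finally have "joint_positive n r' = joint_positive n t"
      by (intro joint_positive_sum_eq r' t)
    moreover have "joint_positive n t = joint_positive n (\<lambda>j. - r j)"
      by (intro joint_positive_cong) (simp add: t_def)
    moreover have "joint_positive n r' = joint_positive n (\<lambda>j. if j \<in> T then -1 else r j)"
      by (intro joint_positive_cong) (simp add: r'_def)
    ultimately show ?thesis
      using joint_positive_flip [OF r T' K] T(2) d by simp
  qed
  show ?thesis
  proof (cases "0 \<le> (\<Sum>k=1..n. r k)")
    case True
    then show ?thesis using pos [OF r True] by (simp only: abs_of_nonneg of_int_0_le_iff)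
  next
    case False
    \<comment> \<open>A negative sum is reduced to the first case by exchanging the roles of
      \<open>r\<close> and its negative.\<close>
    define t where "t = (\<lambda>j\<in>{1..n}. - r j)"
    have t: "t \<in> signs n" unfolding t_def using signsD [OF r] by (intro signsI) auto
    have sum_t: "(\<Sum>k=1..n. t k) = - (\<Sum>k=1..n. r k)" by (simp add: t_def sum_negf)
    have "joint_positive n t = joint_positive n (\<lambda>j. - r j)"
      "joint_positive n (\<lambda>j. - t j) = joint_positive n r"
      by (intro joint_positive_cong; simp add: t_def)+
    then show ?thesis
      using pos [OF t] False unfolding sum_t by (simp add: abs_minus_commute del: of_int_sum)
  qed
qed

text \<open>Positivity of the first sum splits according to the sign of the second into Q(r), Q(-r)
  and a tie. The tie costs \<open>1 / sqrt (real n + 1)\<close>, which turns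
  \<open>4 * real K + 1\<close> into \<open>4 * real K + 2\<close>.\<close>

lemma joint_positive_estimate:
  fixes K :: nat
  assumes r: "r \<in> signs n" and K: "K > 0"
  shows "\<bar>2 * joint_positive n r - freq n (\<lambda>s. 0 < (\<Sum>k=1..n. s k))\<bar>
           \<le> (4 * real K + 2) / sqrt (real n + 1) + \<bar>real_of_int (\<Sum>k=1..n. r k)\<bar> / (real K)\<^sup>2"
proof -
  let ?z = "freq n (\<lambda>s. 0 < (\<Sum>k=1..n. s k) \<and> (\<Sum>k=1..n. s k * r k) = 0)"
  have "?z \<le> freq n (\<lambda>s. (\<Sum>k=1..n. s k * r k) = 0)" by (intro freq_mono) auto
  also have "\<dots> \<le> 1 / sqrt (real n + 1)"
    unfolding freq_inner_cong [OF r, of "\<lambda>y. y = 0"] by (rule freq_sum_eq_le)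
  finally have z: "?z \<le> 1 / sqrt (real n + 1)" .
  have "joint_positive n r + joint_positive n (\<lambda>j. - r j) + ?z = freq n (\<lambda>s. 0 < (\<Sum>k=1..n. s k))"
    unfolding joint_positive_def
    by (subst freq_add, (auto simp: sum_negf)[1], subst freq_add, (auto simp: sum_negf)[1])
       (intro freq_cong, auto simp: sum_negf)
  moreover have "(4 * real K + 2) / sqrt (real n + 1)
      = (4 * real K + 1) / sqrt (real n + 1) + 1 / sqrt (real n + 1)"
    by (simp add: add_divide_distrib)
  ultimately show ?thesis
    using z freq_nonneg [of n "\<lambda>s. 0 < (\<Sum>k=1..n. s k) \<and> (\<Sum>k=1..n. s k * r k) = 0"]
      joint_positive_uminus_diff [OF r K] by linarith
qed

text \<open>Negating all signs shows that both strict signs are equally likely; only the tie at 0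
  separates the probability from one half.\<close>

lemma freq_sum_pos_half:
  "\<bar>freq n (\<lambda>s. 0 < (\<Sum>k=1..n. s k)) - 1 / 2\<bar> \<le> 1 / sqrt (real n + 1)"
proof -
  have "(\<lambda>j\<in>{1..n}. -1) \<in> signs n" by (intro signsI) auto
  from freq_inner_cong [OF this, of "\<lambda>y. 0 < y"]
  have "freq n (\<lambda>s. (\<Sum>k=1..n. s k) < 0) = freq n (\<lambda>s. 0 < (\<Sum>k=1..n. s k))"
    by (simp add: sum_negf)
  moreover have "freq n (\<lambda>s. 0 < (\<Sum>k=1..n. s k)) + freq n (\<lambda>s. (\<Sum>k=1..n. s k) < 0)
      = freq n (\<lambda>s. 0 < (\<Sum>k=1..n. s k) \<or> (\<Sum>k=1..n. s k) < 0)"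
    by (rule freq_add) linarith
  moreover have "freq n (\<lambda>s. 0 < (\<Sum>k=1..n. s k) \<or> (\<Sum>k=1..n. s k) < 0)
      + freq n (\<lambda>s. (\<Sum>k=1..n. s k) = 0) = freq n (\<lambda>_. True)"
    by (subst freq_add, linarith, intro freq_cong) auto
  moreover note freq_True [of n]
  ultimately show ?thesis
    using freq_sum_eq_le [of n 0] freq_nonneg [of n "\<lambda>s. (\<Sum>k=1..n. s k) = 0"] by linarith
qed

section \<open>Size of the sum of biased partial products\<close>

text \<open>With truncated subtraction one of the two differences vanishes, so the exponent is |k -
  l|. On either side of \<open>k\<close> the exponents are distinct, and each part is at most the
  full geometric series.\<close>

lemma sum_power_dist_le:
  fixes \<rho> :: real
  assumes \<rho>: "0 \<le> \<rho>" "\<rho> < 1"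
  shows "(\<Sum>l=1..n. \<rho> ^ ((k - l) + (l - k))) \<le> 2 / (1 - \<rho>)"
proof -
  have geo: "(\<Sum>i\<in>A. \<rho> ^ i) \<le> 1 / (1 - \<rho>)" if "finite A" for A
  proof -
    have "(\<Sum>i\<in>A. \<rho> ^ i) \<le> (\<Sum>i. \<rho> ^ i)"
      using \<rho> that by (intro sum_le_suminf summable_geometric) auto
    then show ?thesis using suminf_geometric [of \<rho>] \<rho> by simp
  qed
  have "(\<Sum>l=1..n. \<rho> ^ ((k - l) + (l - k)))
      = (\<Sum>l | l \<in> {1..n} \<and> l \<le> k. \<rho> ^ (k - l)) + (\<Sum>l | l \<in> {1..n} \<and> \<not> l \<le> k. \<rho> ^ (l - k))"
    by (subst sum.inter_filter, simp)+
       (simp add: sum.distrib [symmetric], intro sum.cong, auto)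
  also have "(\<Sum>l | l \<in> {1..n} \<and> l \<le> k. \<rho> ^ (k - l)) = (\<Sum>i\<in>(\<lambda>l. k - l) ` {l \<in> {1..n}. l \<le> k}. \<rho> ^ i)"
    by (subst sum.reindex) (auto intro!: inj_onI)
  also have "(\<Sum>l | l \<in> {1..n} \<and> \<not> l \<le> k. \<rho> ^ (l - k)) = (\<Sum>i\<in>(\<lambda>l. l - k) ` {l \<in> {1..n}. \<not> l \<le> k}. \<rho> ^ i)"
    by (subst sum.reindex) (auto intro!: inj_onI)
  also have "(\<Sum>i\<in>(\<lambda>l. k - l) ` {l \<in> {1..n}. l \<le> k}. \<rho> ^ i) + \<dots> \<le> 1 / (1 - \<rho>) + 1 / (1 - \<rho>)"
    by (intro add_mono geo) auto
  finally show ?thesis by simp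
qed

text \<open>The factors up to \<open>k\<close> occur twice and square to 1.\<close>

lemma cumprod_mult:
  assumes s: "s \<in> signs n" and kl: "k \<le> l" "l \<le> n"
  shows "(\<Prod>j=1..k. s j) * (\<Prod>j=1..l. s j) = (\<Prod>j\<in>{k<..l}. s j)"
proof -
  have "{1..l} = {1..k} \<union> {k<..l}" using kl by auto
  then have "(\<Prod>j=1..l. s j) = (\<Prod>j=1..k. s j) * (\<Prod>j\<in>{k<..l}. s j)"
    by (simp only:) (rule prod.union_disjoint, auto)
  moreover have "(\<Prod>j=1..k. s j) * (\<Prod>j=1..k. s j) = 1"
    unfolding prod.distrib [symmetric]
    using kl by (intro prod.neutral ballI signs_square [OF s]) auto
  ultimately show ?thesis by (simp flip: mult.assoc)
qed

text \<open>Expanding the square leaves the correlations of two partial products, which are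
  \<rho>^|k - l| since exactly |k - l| independent factors survive.\<close>

lemma sum_bias_weight_cumprod_square:
  fixes \<rho> :: real
  assumes \<rho>: "0 \<le> \<rho>" "\<rho> < 1"
  shows "(\<Sum>s\<in>signs n. bias_weight \<rho> n s * (real_of_int (\<Sum>k=1..n. \<Prod>j=1..k. s j))\<^sup>2)
           \<le> real n * (2 / (1 - \<rho>))"
proof -
  have le: "(\<Sum>s\<in>signs n. bias_weight \<rho> n s * real_of_int ((\<Prod>j=1..k. s j) * (\<Prod>j=1..l. s j))) = \<rho> ^ (l - k)"
    if "k \<le> l" "l \<le> n" for k l
  proof -
    have "(\<Sum>s\<in>signs n. bias_weight \<rho> n s * real_of_int ((\<Prod>j=1..k. s j) * (\<Prod>j=1..l. s j)))
        = (\<Sum>s\<in>signs n. bias_weight \<rho> n s * (\<Prod>j\<in>{k<..l}. real_of_int (s j)))"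
      using that by (intro sum.cong refl) (simp only: cumprod_mult of_int_prod)
    also have "\<dots> = \<rho> ^ (l - k)"
      using that by (subst sum_bias_weight_prod) auto
    finally show ?thesis .
  qed
  have eq: "(\<Sum>s\<in>signs n. bias_weight \<rho> n s * real_of_int ((\<Prod>j=1..k. s j) * (\<Prod>j=1..l. s j)))
      = \<rho> ^ ((k - l) + (l - k))" if "k \<in> {1..n}" "l \<in> {1..n}" for k l
  proof (cases "k \<le> l")
    case True
    then show ?thesis using le [of k l] that by simp
  next
    case False
    then show ?thesis using le [of l k] that by (simp add: mult.commute)
  qed
  have "(\<Sum>s\<in>signs n. bias_weight \<rho> n s * (real_of_int (\<Sum>k=1..n. \<Prod>j=1..k. s j))\<^sup>2)
      = (\<Sum>s\<in>signs n. \<Sum>k=1..n. \<Sum>l=1..n. bias_weight \<rho> n s * real_of_int ((\<Prod>j=1..k. s j) * (\<Prod>j=1..l. s j)))"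
    unfolding power2_eq_square of_int_mult of_int_sum sum_product by (simp only: sum_distrib_left)
  also have "\<dots> = (\<Sum>k=1..n. \<Sum>l=1..n. \<Sum>s\<in>signs n. bias_weight \<rho> n s * real_of_int ((\<Prod>j=1..k. s j) * (\<Prod>j=1..l. s j)))"
    by (subst sum.swap, intro sum.cong refl, rule sum.swap)
  also have "\<dots> = (\<Sum>k=1..n. \<Sum>l=1..n. \<rho> ^ ((k - l) + (l - k)))"
    by (intro sum.cong refl eq) auto
  also have "\<dots> \<le> (\<Sum>k=1..n. 2 / (1 - \<rho>))"
    by (intro sum_mono sum_power_dist_le \<rho>)
  finally show ?thesis by simp
qed

lemma sum_bias_weight_abs_cumprod:
  fixes \<rho> v :: real
  assumes \<rho>: "0 \<le> \<rho>" "\<rho> < 1" and n: "n \<ge> 1" and v: "v > 0" "2 / (1 - \<rho>) \<le> n * v ^ 8"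
  shows "(\<Sum>s\<in>signs n. bias_weight \<rho> n s * \<bar>real_of_int (\<Sum>k=1..n. \<Prod>j=1..k. s j)\<bar>) \<le> n * v ^ 4"
proof -
  \<comment> \<open>The hypothesis on \<open>v\<close> makes the second moment at most
    \<open>L\<^sup>2\<close>, so the inequality of arithmetic and geometric means at scale
    \<open>L\<close> bounds the first moment by \<open>L\<close>.\<close>
  define L where "L = n * v ^ 4"
  have L: "L > 0" using n v by (simp add: L_def)
  have amgm: "\<bar>y\<bar> \<le> (y\<^sup>2 / L + L) / 2" for y :: real
  proof -
    have "0 \<le> (\<bar>y\<bar> - L)\<^sup>2" by simp
    then have "2 * \<bar>y\<bar> * L \<le> y\<^sup>2 + L\<^sup>2" by (simp add: power2_diff)
    then show ?thesis using L by (simp add: field_simps power2_eq_square)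
  qed
  have "(\<Sum>s\<in>signs n. bias_weight \<rho> n s * \<bar>real_of_int (\<Sum>k=1..n. \<Prod>j=1..k. s j)\<bar>)
      \<le> (\<Sum>s\<in>signs n. bias_weight \<rho> n s * (((real_of_int (\<Sum>k=1..n. \<Prod>j=1..k. s j))\<^sup>2 / L + L) / 2))"
    using \<rho> by (intro sum_mono mult_left_mono amgm bias_weight_nonneg) auto
  also have "\<dots> = ((\<Sum>s\<in>signs n. bias_weight \<rho> n s * (real_of_int (\<Sum>k=1..n. \<Prod>j=1..k. s j))\<^sup>2) / L
      + L * (\<Sum>s\<in>signs n. bias_weight \<rho> n s)) / 2"
    unfolding sum_divide_distrib sum_distrib_left sum.distrib [symmetric]
    by (intro sum.cong refl) (simp add: field_simps)
  also have "\<dots> \<le> (real n * (n * v ^ 8) / L + L * 1) / 2"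
  proof -
    have "(\<Sum>s\<in>signs n. bias_weight \<rho> n s * (real_of_int (\<Sum>k=1..n. \<Prod>j=1..k. s j))\<^sup>2) \<le> real n * (n * v ^ 8)"
      using sum_bias_weight_cumprod_square [OF \<rho>, of n] mult_left_mono [OF v(2), of "real n"] by linarith
    then show ?thesis unfolding sum_bias_weight
      using L by (intro divide_right_mono add_right_mono) auto
  qed
  also have "real n * (n * v ^ 8) / L = L"
    using n v by (simp add: L_def field_simps flip: power_add)
  finally show ?thesis by (simp add: L_def)
qed

text \<open>Averaging \<open>joint_positive_estimate\<close> over the biased vectors puts the
  average near \<open>p / 2\<close>, which is close to \<open>p\<^sup>2\<close> because
  \<open>p\<close> is close to one half.\<close>

lemma joint_positive_average:
  fixes \<rho> v :: real
  assumes \<rho>: "0 \<le> \<rho>" "\<rho> < 1" and n: "n \<ge> 1" and v: "v > 0" "2 / (1 - \<rho>) \<le> n * v ^ 8"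
  defines "p \<equiv> freq n (\<lambda>s. 0 < (\<Sum>k=1..n. s k))"
  shows "\<bar>(\<Sum>s\<in>signs n. bias_weight \<rho> n s * joint_positive n (\<lambda>k. \<Prod>j=1..k. s j)) - p\<^sup>2\<bar>
           \<le> 4 * v + v\<^sup>2 + 8 / sqrt (real n + 1)"
proof -
  define c where "c = sqrt (real n + 1)"
  have c: "c > 0" "sqrt n \<le> c" by (auto simp: c_def)
  \<comment> \<open>Since \<open>|D|\<close> is about \<open>n v\<^sup>4\<close>, both \<open>K / sqrt n\<close> and \<open>|D| / K\<^sup>2\<close> become small.\<close>
  define K where "K = nat \<lceil>sqrt n * v\<rceil>"
  have nv: "sqrt n * v > 0" using n v by simp
  then have K: "K > 0" "sqrt n * v \<le> K" "K \<le> sqrt n * v + 1" unfolding K_def by linarith+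
  let ?J = "\<Sum>s\<in>signs n. bias_weight \<rho> n s * joint_positive n (\<lambda>k. \<Prod>j=1..k. s j)"
  let ?D = "\<lambda>s. real_of_int (\<Sum>k=1..n. \<Prod>j=1..k. s j)"
  have est: "\<bar>2 * joint_positive n (\<lambda>k. \<Prod>j=1..k. s j) - p\<bar> \<le> (4 * real K + 2) / c + \<bar>?D s\<bar> / (real K)\<^sup>2"
    if s: "s \<in> signs n" for s
  proof -
    let ?r = "\<lambda>k\<in>{1..n}. \<Prod>j=1..k. s j"
    have "?r \<in> signs n" using bij_betwE [OF bij_betw_signs_cumprod] s by blast
    from joint_positive_estimate [OF this K(1)] show ?thesis
      using joint_positive_cong [of n ?r "\<lambda>k. \<Prod>j=1..k. s j"] by (simp add: p_def c_def)
  qed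
  have "2 * ?J - p = (\<Sum>s\<in>signs n. bias_weight \<rho> n s * (2 * joint_positive n (\<lambda>k. \<Prod>j=1..k. s j) - p))"
  proof -
    have "(\<Sum>s\<in>signs n. bias_weight \<rho> n s * p) = p"
      by (simp add: sum_bias_weight flip: sum_distrib_right)
    then show ?thesis by (simp add: right_diff_distrib sum_subtractf sum_distrib_left mult_ac)
  qed
  also have "\<bar>\<dots>\<bar> \<le> (\<Sum>s\<in>signs n. bias_weight \<rho> n s * ((4 * real K + 2) / c + \<bar>?D s\<bar> / (real K)\<^sup>2))"
  proof (intro order_trans [OF sum_abs] sum_mono)
    fix s assume s: "s \<in> signs n"
    then show "\<bar>bias_weight \<rho> n s * (2 * joint_positive n (\<lambda>k. \<Prod>j=1..k. s j) - p)\<bar>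
        \<le> bias_weight \<rho> n s * ((4 * real K + 2) / c + \<bar>?D s\<bar> / (real K)\<^sup>2)"
      using est [OF s] bias_weight_nonneg [OF _ _ s, of \<rho>] \<rho> by (simp add: abs_mult mult_left_mono)
  qed
  also have "\<dots> = (4 * real K + 2) / c * (\<Sum>s\<in>signs n. bias_weight \<rho> n s)
      + (\<Sum>s\<in>signs n. bias_weight \<rho> n s * \<bar>?D s\<bar>) / (real K)\<^sup>2"
    unfolding sum_divide_distrib sum_distrib_left sum.distrib [symmetric]
    by (intro sum.cong refl) (simp add: distrib_left mult.commute)
  also have "\<dots> \<le> (4 * real K + 2) / c + (n * v ^ 4) / (real K)\<^sup>2"
    using sum_bias_weight_abs_cumprod [OF \<rho> n v] by (simp add: sum_bias_weight divide_right_mono)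
  \<comment> \<open>The first term uses the upper bound on \<open>K\<close>, the rounding costing at
    most 1; the second uses the lower bound.\<close>
  also have "\<dots> \<le> (4 * v + 6 / c) + v\<^sup>2"
  proof (rule add_mono)
    have "4 * real K + 2 \<le> 4 * (c * v) + 6" using K(3) mult_right_mono [OF c(2), of v] v by linarith
    then have "(4 * real K + 2) / c \<le> (4 * (c * v) + 6) / c"
      using c by (intro divide_right_mono) auto
    then show "(4 * real K + 2) / c \<le> 4 * v + 6 / c" using c by (simp add: add_divide_distrib)
    have "n * v\<^sup>2 = (sqrt n * v)\<^sup>2" by (simp add: power_mult_distrib)
    also have "\<dots> \<le> (real K)\<^sup>2" using K nv by (intro power_mono) auto
    finally have "n * v\<^sup>2 * v\<^sup>2 \<le> (real K)\<^sup>2 * v\<^sup>2" by (intro mult_right_mono) auto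
    then show "n * v ^ 4 / (real K)\<^sup>2 \<le> v\<^sup>2" using K(1) by (simp add: field_simps flip: power_add)
  qed
  finally have 1: "\<bar>2 * ?J - p\<bar> \<le> 4 * v + 6 / c + v\<^sup>2" .
  have p01: "0 \<le> p" "p \<le> 1" unfolding p_def by (rule freq_nonneg freq_le_1)+
  have "\<bar>p * (p - 1 / 2)\<bar> \<le> 1 * (1 / c)"
    unfolding abs_mult using p01 freq_sum_pos_half [of n] by (intro mult_mono) (auto simp: p_def c_def)
  then have 2: "\<bar>p\<^sup>2 - p / 2\<bar> \<le> 1 / c" by (simp add: power2_eq_square right_diff_distrib)
  have "6 / c = 6 * (1 / c)" "8 / c = 8 * (1 / c)" "0 < 1 / c" using c by simp_all
  moreover have "0 \<le> v\<^sup>2" by simp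
  \<comment> \<open>Half of the first bound plus the second is
    \<open>2 * v + v\<^sup>2 / 2 + 4 / c\<close>, half of what is claimed.\<close>
  ultimately have "\<bar>?J - p\<^sup>2\<bar> \<le> 4 * v + v\<^sup>2 + 8 / c"
    using 1 2 v unfolding abs_le_iff by linarith
  then show ?thesis by (simp add: c_def)
qed

subsection \<open>The law of the walk at two times\<close>

text \<open>Writing \<open>b\<close> as the pointwise product of \<open>s\<close> and
  \<open>a\<close> turns the correlated pair weight into a biased weight for \<open>s\<close> times
  a uniform weight for \<open>a\<close>. Then \<open>a\<close> is replaced by its partial
  products.\<close>

lemma sum_sign_pairs:
  fixes \<rho> :: real
  shows "(\<Sum>a\<in>signs n. \<Sum>b\<in>signs n. (\<Prod>j=1..n. (1 + \<rho> * a j * b j) / 4) *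
            of_bool (\<Phi> (\<Sum>k=1..n. \<Prod>j=1..k. a j) (\<Sum>k=1..n. \<Prod>j=1..k. b j)))
       = (\<Sum>s\<in>signs n. bias_weight \<rho> n s * freq n (\<lambda>x. \<Phi> (\<Sum>k=1..n. x k) (\<Sum>k=1..n. x k * (\<Prod>j=1..k. s j))))"
proof -
  let ?F = "\<lambda>a b. (\<Prod>j=1..n. (1 + \<rho> * a j * b j) / 4) *
            of_bool (\<Phi> (\<Sum>k=1..n. \<Prod>j=1..k. a j) (\<Sum>k=1..n. \<Prod>j=1..k. b j))"
  let ?G = "\<lambda>s a. bias_weight \<rho> n s / 2 ^ n *
     of_bool (\<Phi> (\<Sum>k=1..n. \<Prod>j=1..k. a j) (\<Sum>k=1..n. (\<Prod>j=1..k. a j) * (\<Prod>j=1..k. s j)))"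
  have inner: "(\<Sum>b\<in>signs n. ?F a b) = (\<Sum>s\<in>signs n. ?G s a)" if a: "a \<in> signs n" for a
  proof -
    have "(\<Sum>b\<in>signs n. ?F a b) = (\<Sum>s\<in>signs n. ?F a (\<lambda>j\<in>{1..n}. s j * a j))"
      by (rule sum.reindex_bij_betw [OF bij_betw_signs_mult [OF a], symmetric])
    also have "\<dots> = (\<Sum>s\<in>signs n. ?G s a)"
    proof (rule sum.cong [OF refl])
      fix s assume s: "s \<in> signs n"
      have 1: "(\<Prod>j=1..k. (\<lambda>j\<in>{1..n}. s j * a j) j) = (\<Prod>j=1..k. a j) * (\<Prod>j=1..k. s j)"
        if "k \<in> {1..n}" for k
        unfolding prod.distrib [symmetric] using that by (intro prod.cong) auto
      have "(\<Prod>j=1..n. (1 + \<rho> * a j * (\<lambda>j\<in>{1..n}. s j * a j) j) / 4) = (\<Prod>j=1..n. (1 + \<rho> * s j) / 2 * (1 / 2))"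
      proof (rule prod.cong [OF refl])
        \<comment> \<open>Here \<open>a j * a j = 1\<close>, so \<open>a\<close> drops out of the
          weight.\<close>
        fix j assume j: "j \<in> {1..n}"
        then show "(1 + \<rho> * a j * (\<lambda>j\<in>{1..n}. s j * a j) j) / 4 = (1 + \<rho> * s j) / 2 * (1 / 2)"
          using signsD [OF a j] by auto
      qed
      also have "\<dots> = bias_weight \<rho> n s / 2 ^ n"
        unfolding prod.distrib by (simp add: bias_weight_def power_one_over)
      finally have 2: "(\<Prod>j=1..n. (1 + \<rho> * a j * (\<lambda>j\<in>{1..n}. s j * a j) j) / 4) = bias_weight \<rho> n s / 2 ^ n" .
      have 3: "(\<Sum>k=1..n. \<Prod>j=1..k. (\<lambda>j\<in>{1..n}. s j * a j) j) = (\<Sum>k=1..n. (\<Prod>j=1..k. a j) * (\<Prod>j=1..k. s j))"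
        by (rule sum.cong [OF refl 1])
      show "?F a (\<lambda>j\<in>{1..n}. s j * a j) = ?G s a" by (simp only: 2 3)
    qed
    finally show ?thesis .
  qed
  have "(\<Sum>a\<in>signs n. \<Sum>b\<in>signs n. ?F a b) = (\<Sum>a\<in>signs n. \<Sum>s\<in>signs n. ?G s a)"
    by (rule sum.cong [OF refl inner])
  also have "\<dots> = (\<Sum>s\<in>signs n. \<Sum>a\<in>signs n. ?G s a)" by (rule sum.swap)
  also have "\<dots> = (\<Sum>s\<in>signs n. bias_weight \<rho> n s * freq n (\<lambda>x. \<Phi> (\<Sum>k=1..n. x k) (\<Sum>k=1..n. x k * (\<Prod>j=1..k. s j))))"
  proof (rule sum.cong [OF refl])
    fix s
    let ?P = "\<lambda>x. \<Phi> (\<Sum>k=1..n. x k) (\<Sum>k=1..n. x k * (\<Prod>j=1..k. s j))"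
    have "(\<Sum>a\<in>signs n. ?G s a) = bias_weight \<rho> n s * freq n (\<lambda>a. ?P (\<lambda>k\<in>{1..n}. \<Prod>j=1..k. a j))"
      by (simp add: freq_def sum_distrib_left sum_divide_distrib del: sum_of_bool_eq)
    also have "freq n (\<lambda>a. ?P (\<lambda>k\<in>{1..n}. \<Prod>j=1..k. a j)) = freq n ?P"
      by (rule freq_bij [OF bij_betw_signs_cumprod])
    finally show "(\<Sum>a\<in>signs n. ?G s a) = bias_weight \<rho> n s * freq n ?P" .
  qed
  finally show ?thesis .
qed

lemma measurable_count_space_binop:
  fixes f g :: "'a \<Rightarrow> 'b::countable"
  assumes f: "f \<in> measurable M (count_space UNIV)" and g: "g \<in> measurable M (count_space UNIV)"
  shows "(\<lambda>x. h (f x) (g x)) \<in> measurable M (count_space UNIV)"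
proof (rule measurable_compose_countable [OF _ f])
  fix i show "(\<lambda>x. h i (g x)) \<in> measurable M (count_space UNIV)"
    by (rule measurable_compose [OF g]) simp
qed

lemma measurable_count_space_prod:
  fixes f :: "'i \<Rightarrow> 'a \<Rightarrow> int"
  assumes "\<And>i. i \<in> I \<Longrightarrow> f i \<in> measurable M (count_space UNIV)"
  shows "(\<lambda>x. \<Prod>i\<in>I. f i x) \<in> measurable M (count_space UNIV)"
  using assms by (induction I rule: infinite_finite_induct) (auto intro: measurable_count_space_binop)

lemma measurable_count_space_sum:
  fixes f :: "'i \<Rightarrow> 'a \<Rightarrow> int"
  assumes "\<And>i. i \<in> I \<Longrightarrow> f i \<in> measurable M (count_space UNIV)"
  shows "(\<lambda>x. \<Sum>i\<in>I. f i x) \<in> measurable M (count_space UNIV)"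
  using assms by (induction I rule: infinite_finite_induct) (auto intro: measurable_count_space_binop)

context prob_space
begin

text \<open>The variables are not assumed to be signs everywhere. The prescribed probabilities add
  up to 1, so almost surely they are, and the probability of any event in the two walks is a finite
  sum over pairs of sign vectors.\<close>

lemma prob_sign_pairs:
  fixes \<sigma> \<tau> :: "nat \<Rightarrow> 'a \<Rightarrow> int" and \<rho> :: real
  assumes meas: "\<And>j. j \<in> {1..n} \<Longrightarrow> \<sigma> j \<in> measurable M (count_space UNIV)"
      "\<And>j. j \<in> {1..n} \<Longrightarrow> \<tau> j \<in> measurable M (count_space UNIV)"
    and pair: "\<And>a b. \<lbrakk>a \<in> signs n; b \<in> signs n\<rbrakk> \<Longrightarrow>
       prob {\<omega> \<in> space M. \<forall>j\<in>{1..n}. \<sigma> j \<omega> = a j \<and> \<tau> j \<omega> = b j} = (\<Prod>j=1..n. (1 + \<rho> * a j * b j) / 4)"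
  shows "prob {\<omega> \<in> space M. \<Phi> (\<Sum>k=1..n. \<Prod>j=1..k. \<sigma> j \<omega>) (\<Sum>k=1..n. \<Prod>j=1..k. \<tau> j \<omega>)}
       = (\<Sum>s\<in>signs n. bias_weight \<rho> n s * freq n (\<lambda>x. \<Phi> (\<Sum>k=1..n. x k) (\<Sum>k=1..n. x k * (\<Prod>j=1..k. s j))))"
proof -
  define E where "E = (\<lambda>(a, b). {\<omega> \<in> space M. \<forall>j\<in>{1..n}. \<sigma> j \<omega> = a j \<and> \<tau> j \<omega> = b j})"
  let ?I = "signs n \<times> signs n"
  let ?A = "{\<omega> \<in> space M. \<Phi> (\<Sum>k=1..n. \<Prod>j=1..k. \<sigma> j \<omega>) (\<Sum>k=1..n. \<Prod>j=1..k. \<tau> j \<omega>)}"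
  let ?\<Psi> = "\<lambda>(a, b). \<Phi> (\<Sum>k=1..n. \<Prod>j=1..k. a j) (\<Sum>k=1..n. \<Prod>j=1..k. b j :: int)"
  let ?S = "\<lambda>\<omega>. ((\<Sum>k=1..n. \<Prod>j=1..k. \<sigma> j \<omega>), (\<Sum>k=1..n. \<Prod>j=1..k. \<tau> j \<omega>))"
  have Eset: "E x \<in> events" for x
  proof (cases x)
    case (Pair a b)
    have "{\<omega> \<in> space M. \<sigma> j \<omega> = a j \<and> \<tau> j \<omega> = b j} \<in> events" if "j \<in> {1..n}" for j
      using measurable_sets [OF meas(1) [OF that], of "{a j}"] measurable_sets [OF meas(2) [OF that], of "{b j}"]
      by (auto simp: vimage_def Int_def conj_commute intro!: sets.sets_Collect_conj)
    then have "{\<omega> \<in> space M. \<forall>j\<in>{1..n}. \<sigma> j \<omega> = a j \<and> \<tau> j \<omega> = b j} \<in> events"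
      by (intro sets.sets_Collect_finite_All) auto
    then show ?thesis by (simp add: E_def Pair)
  qed
  have disj: "disjoint_family_on E ?I"
    unfolding disjoint_family_on_def
  proof (intro ballI impI)
    fix x y assume xy: "x \<in> ?I" "y \<in> ?I" "x \<noteq> y"
    obtain a b c d where [simp]: "x = (a, b)" "y = (c, d)" by (cases x, cases y)
    show "E x \<inter> E y = {}"
    proof (rule ccontr)
      assume "E x \<inter> E y \<noteq> {}"
      then obtain \<omega> where "\<forall>j\<in>{1..n}. \<sigma> j \<omega> = a j \<and> \<tau> j \<omega> = b j" "\<forall>j\<in>{1..n}. \<sigma> j \<omega> = c j \<and> \<tau> j \<omega> = d j"
        by (auto simp: E_def)
      then have "a = c" "b = d" using xy by (auto intro!: signs_eqI [of _ n])
      then show False using xy by simp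
    qed
  qed
  have fin: "finite ?I" by simp
  \<comment> \<open>Kept general in \<open>P\<close>: the constant \<open>True\<close> gives total
    mass 1, and \<Phi> gives the claim.\<close>
  have split: "prob (\<Union>x\<in>{x \<in> ?I. P (case x of (a, b) \<Rightarrow> ((\<Sum>k=1..n. \<Prod>j=1..k. a j), (\<Sum>k=1..n. \<Prod>j=1..k. b j)))}. E x)
      = (\<Sum>s\<in>signs n. bias_weight \<rho> n s * freq n (\<lambda>x. P ((\<Sum>k=1..n. x k), (\<Sum>k=1..n. x k * (\<Prod>j=1..k. s j)))))"
    for P :: "int \<times> int \<Rightarrow> bool"
  proof -
    let ?Q = "\<lambda>x. P (case x of (a, b) \<Rightarrow> ((\<Sum>k=1..n. \<Prod>j=1..k. a j), (\<Sum>k=1..n. \<Prod>j=1..k. b j)))"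
    have "prob (\<Union>x\<in>{x \<in> ?I. ?Q x}. E x) = (\<Sum>x\<in>{x \<in> ?I. ?Q x}. prob (E x))"
      using Eset by (intro finite_measure_finite_Union disjoint_family_on_mono [OF _ disj]) auto
    also have "\<dots> = (\<Sum>x\<in>?I. prob (E x) * of_bool (?Q x))"
      by (subst sum.inter_filter [OF fin]) (intro sum.cong, auto)
    also have "\<dots> = (\<Sum>a\<in>signs n. \<Sum>b\<in>signs n. prob (E (a, b)) * of_bool (?Q (a, b)))"
      by (simp only: sum.cartesian_product) (intro sum.cong, auto)
    also have "\<dots> = (\<Sum>a\<in>signs n. \<Sum>b\<in>signs n. (\<Prod>j=1..n. (1 + \<rho> * a j * b j) / 4) * of_bool (?Q (a, b)))"
      by (intro sum.cong refl) (simp only: E_def prod.case pair)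
    finally show ?thesis
      unfolding prod.case using sum_sign_pairs [of \<rho> n "\<lambda>u v. P (u, v)"] by simp
  qed
  let ?V = "\<Union>x\<in>?I. E x"
  have "prob ?V = 1"
    using split [of "\<lambda>_. True"] by (simp add: freq_True sum_bias_weight)
  then have AE: "AE \<omega> in M. \<omega> \<in> ?V"
    using Eset by (subst (asm) prob_eq_1) (auto intro!: sets.finite_UN)
  have inE: "\<omega> \<in> E (a, b) \<Longrightarrow> ?S \<omega> = ((\<Sum>k=1..n. \<Prod>j=1..k. a j), (\<Sum>k=1..n. \<Prod>j=1..k. b j))" for \<omega> a b
    by (auto simp: E_def intro!: sum.cong prod.cong)
  have Sm: "?A \<in> events"
  proof -
    have "(\<lambda>\<omega>. \<Sum>k=1..n. \<Prod>j=1..k. \<sigma> j \<omega>) \<in> measurable M (count_space UNIV)"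
      "(\<lambda>\<omega>. \<Sum>k=1..n. \<Prod>j=1..k. \<tau> j \<omega>) \<in> measurable M (count_space UNIV)"
      by (intro measurable_count_space_sum measurable_count_space_prod meas; simp)+
    from measurable_count_space_binop [OF this, of \<Phi>] show ?thesis by (rule pred_def [THEN iffD1])
  qed
  have "prob ?A = prob (\<Union>x\<in>{x \<in> ?I. (\<lambda>(u, v). \<Phi> u v) (case x of (a, b) \<Rightarrow> ((\<Sum>k=1..n. \<Prod>j=1..k. a j), (\<Sum>k=1..n. \<Prod>j=1..k. b j)))}. E x)"
  proof (rule finite_measure_eq_AE)
    show "AE \<omega> in M. \<omega> \<in> ?A \<longleftrightarrow> \<omega> \<in> (\<Union>x\<in>{x \<in> ?I. (\<lambda>(u, v). \<Phi> u v) (case x of (a, b) \<Rightarrow> ((\<Sum>k=1..n. \<Prod>j=1..k. a j), (\<Sum>k=1..n. \<Prod>j=1..k. b j)))}. E x)"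
      using AE
    proof eventually_elim
      case (elim \<omega>)
      then have sp: "\<omega> \<in> space M" by (auto simp: E_def)
      have "\<omega> \<in> ?A \<longleftrightarrow> (\<lambda>(u, v). \<Phi> u v) (?S \<omega>)" using sp by simp
      moreover obtain a b where ab: "a \<in> signs n" "b \<in> signs n" "\<omega> \<in> E (a, b)" using elim by auto
      ultimately show ?case using inE by fastforce
    qed
  qed (use Eset Sm in \<open>auto intro!: sets.finite_UN\<close>)
  then show ?thesis using split [of "\<lambda>(u, v). \<Phi> u v"] by simp
qed

end

section \<open>Signs resampled at Poisson times\<close>

locale switch_environment = prob_space M for M :: "'a measure" +
  fixes X :: "nat \<Rightarrow> nat \<Rightarrow> 'a \<Rightarrow> int"
    and N :: "nat \<Rightarrow> real \<Rightarrow> 'a \<Rightarrow> nat"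
  assumes X_distr: "\<And>j i. j \<ge> 1 \<Longrightarrow>
       distr M (count_space UNIV) (X j i) = measure_pmf (pmf_of_set {-1, 1})"
    and X_meas: "\<And>j i. j \<ge> 1 \<Longrightarrow> X j i \<in> measurable M (count_space UNIV)"
    and N_pp: "\<And>j. j \<ge> 1 \<Longrightarrow> poisson_process M (N j)"
    and indep: "indep_sets
       (\<lambda>k. case k of
           Inl (j, i) \<Rightarrow> sigma_sets (space M) {X j i -` A \<inter> space M | A. True}
         | Inr j \<Rightarrow> sigma_sets (space M) {N j t -` A \<inter> space M | t A. t \<ge> 0})
       (Inl ` {(j, i). j \<ge> 1} \<union> Inr ` {j. j \<ge> 1})"
begin

definition source_events :: "nat \<times> nat + nat \<Rightarrow> 'a set set" where
  "source_events k = (case k of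
      Inl (j, i) \<Rightarrow> sigma_sets (space M) {X j i -` A \<inter> space M | A. True}
    | Inr j \<Rightarrow> sigma_sets (space M) {N j t -` A \<inter> space M | t A. t \<ge> 0})"

text \<open>All sources of randomness behind coordinate \<open>j\<close>: its clock and its whole
  sequence of signs. These index sets are disjoint for different \<open>j\<close>, which allows
  grouping by coordinate.\<close>

definition coord_sources :: "nat \<Rightarrow> (nat \<times> nat + nat) set" where
  "coord_sources j = insert (Inr j) (range (\<lambda>i. Inl (j, i)))"

lemma indep_source_events: "indep_sets source_events (\<Union>j\<in>{1..}. coord_sources j)"
  by (rule indep_sets_mono [OF indep]) (auto simp: source_events_def coord_sources_def)

lemma N_meas: "j \<ge> 1 \<Longrightarrow> t \<ge> 0 \<Longrightarrow> N j t \<in> measurable M (count_space UNIV)"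
  using N_pp unfolding poisson_process_def by blast

lemma N_0: "j \<ge> 1 \<Longrightarrow> \<omega> \<in> space M \<Longrightarrow> N j 0 \<omega> = 0"
  using N_pp unfolding poisson_process_def by blast

lemma N_distr:
  assumes "j \<ge> 1" "t > 0"
  shows "distr M (count_space UNIV) (N j t) = measure_pmf (poisson_pmf t)"
proof -
  have "distr M (count_space UNIV) (N j t) = distr M (count_space UNIV) (\<lambda>\<omega>. N j t \<omega> - N j 0 \<omega>)"
    using N_0 [OF assms(1)] by (intro distr_cong) auto
  also have "\<dots> = measure_pmf (poisson_pmf (t - 0))"
    using N_pp [OF assms(1)] assms(2) unfolding poisson_process_def by blast
  finally show ?thesis by simp
qed

lemma X_event: "{\<omega> \<in> space M. X j i \<omega> = a} \<in> source_events (Inl (j, i))"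
  by (auto simp: source_events_def intro!: sigma_sets.Basic exI [of _ "{a}"])

lemma N_event: "t \<ge> 0 \<Longrightarrow> {\<omega> \<in> space M. N j t \<omega> = i} \<in> source_events (Inr j)"
  by (auto simp: source_events_def intro!: sigma_sets.Basic exI [of _ t] exI [of _ "{i}"])

lemma source_events_subset: "source_events k \<subseteq> Pow (space M)"
  unfolding source_events_def
  by (auto split: sum.splits dest!: sigma_sets_into_sp [rotated])

text \<open>Needed for \<open>indep_sets_collect_sigma\<close>, which groups independent families
  into generated sigma-algebras.\<close>

lemma Int_stable_source_events: "Int_stable (source_events k)"
proof -
  have *: "Int_stable (sigma_sets (space M) S)" if "S \<subseteq> Pow (space M)" for S
  proof -
    interpret sigma_algebra "space M" "sigma_sets (space M) S"
      by (rule sigma_algebra_sigma_sets [OF that])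
    show ?thesis by (auto simp: Int_stable_def)
  qed
  show ?thesis unfolding source_events_def by (cases k) (auto intro!: *)
qed

lemma prob_X_eq:
  assumes "j \<ge> 1" "a \<in> {-1, 1}"
  shows "prob {\<omega> \<in> space M. X j i \<omega> = a} = 1 / 2"
proof -
  have "prob {\<omega> \<in> space M. X j i \<omega> = a} = measure (distr M (count_space UNIV) (X j i)) {a}"
    by (subst measure_distr [OF X_meas [OF assms(1)]]) (auto simp: vimage_def Int_def conj_commute)
  also have "\<dots> = 1 / 2"
    using assms by (simp add: X_distr measure_pmf_single)
  finally show ?thesis .
qed

lemma prob_N_eq:
  assumes "j \<ge> 1" "t > 0"
  shows "prob {\<omega> \<in> space M. N j t \<omega> = i} = pmf (poisson_pmf t) i"
proof -
  have "prob {\<omega> \<in> space M. N j t \<omega> = i} = measure (distr M (count_space UNIV) (N j t)) {i}"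
    using assms by (subst measure_distr [OF N_meas]) (auto simp: vimage_def Int_def conj_commute)
  then show ?thesis using assms by (simp add: N_distr measure_pmf_single)
qed

text \<open>Fixing the number \<open>i\<close> of jumps makes the random index deterministic. For
  \<open>i = 0\<close> both values are the same variable; otherwise they are two independent
  signs.\<close>

lemma prob_switch_pair_given_jumps:
  assumes j: "j \<ge> 1" and t: "t > 0" and ab: "a \<in> {-1, 1}" "b \<in> {-1, 1}"
  shows "prob {\<omega> \<in> space M. X j 0 \<omega> = a \<and> N j t \<omega> = i \<and> X j i \<omega> = b}
       = (if i = 0 then of_bool (a = b) / 2 else 1 / 4) * pmf (poisson_pmf t) i"
proof (cases "i = 0")
  case True
  show ?thesis
  proof (cases "a = b")
    case ab: True
    let ?A = "\<lambda>k. case k of Inl _ \<Rightarrow> {\<omega> \<in> space M. X j 0 \<omega> = a} | Inr _ \<Rightarrow> {\<omega> \<in> space M. N j t \<omega> = 0}"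
    have "prob (\<Inter>k\<in>{Inl (j, 0::nat), Inr j}. ?A k) = (\<Prod>k\<in>{Inl (j, 0::nat), Inr j}. prob (?A k))"
      by (rule indep_setsD [OF indep_source_events])
         (use j t in \<open>auto simp: coord_sources_def X_event N_event\<close>)
    moreover have "(\<Inter>k\<in>{Inl (j, 0::nat), Inr j}. ?A k) = {\<omega> \<in> space M. X j 0 \<omega> = a \<and> N j t \<omega> = i \<and> X j i \<omega> = b}"
      using True ab by auto
    ultimately show ?thesis
      using True ab assms by (simp add: prob_X_eq prob_N_eq)
  next
    case ab: False
    then have "{\<omega> \<in> space M. X j 0 \<omega> = a \<and> N j t \<omega> = i \<and> X j i \<omega> = b} = {}"
      using True by auto
    then have "prob {\<omega> \<in> space M. X j 0 \<omega> = a \<and> N j t \<omega> = i \<and> X j i \<omega> = b} = 0"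
      by (simp only: measure_empty)
    then show ?thesis using True ab by simp
  qed
next
  case False
  let ?A = "\<lambda>k. case k of Inl (j, l) \<Rightarrow> {\<omega> \<in> space M. X j l \<omega> = (if l = 0 then a else b)}
      | Inr _ \<Rightarrow> {\<omega> \<in> space M. N j t \<omega> = i}"
  have "prob (\<Inter>k\<in>{Inl (j, 0), Inl (j, i), Inr j}. ?A k) = (\<Prod>k\<in>{Inl (j, 0), Inl (j, i), Inr j}. prob (?A k))"
    by (rule indep_setsD [OF indep_source_events])
       (use j t in \<open>auto simp: coord_sources_def X_event N_event\<close>)
  moreover have "(\<Inter>k\<in>{Inl (j, 0), Inl (j, i), Inr j}. ?A k) = {\<omega> \<in> space M. X j 0 \<omega> = a \<and> N j t \<omega> = i \<and> X j i \<omega> = b}"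
    using False by auto
  ultimately show ?thesis
    using False assms by (simp add: prob_X_eq prob_N_eq)
qed

lemma switch_pair_eq_UN:
  "{\<omega> \<in> space M. X j 0 \<omega> = a \<and> X j (N j t \<omega>) \<omega> = b}
     = (\<Union>i. {\<omega> \<in> space M. X j 0 \<omega> = a \<and> N j t \<omega> = i \<and> X j i \<omega> = b})"
  by auto

text \<open>Splitting over the number of jumps writes the event as a countable union built from the
  sources of coordinate \<open>j\<close> alone.\<close>

lemma switch_pair_event:
  assumes "t \<ge> 0"
  shows "{\<omega> \<in> space M. X j 0 \<omega> = a \<and> X j (N j t \<omega>) \<omega> = b}
     \<in> sigma_sets (space M) (\<Union>k\<in>coord_sources j. source_events k)"
proof -
  let ?S = "\<Union>k\<in>coord_sources j. source_events k"
  interpret S: sigma_algebra "space M" "sigma_sets (space M) ?S"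
    using source_events_subset by (intro sigma_algebra_sigma_sets) blast
  have X: "{\<omega> \<in> space M. X j i \<omega> = c} \<in> sigma_sets (space M) ?S" for i c
    using X_event by (intro sigma_sets.Basic UN_I [of "Inl (j, i)"]) (auto simp: coord_sources_def)
  have N: "{\<omega> \<in> space M. N j t \<omega> = i} \<in> sigma_sets (space M) ?S" for i
    using N_event [OF assms] by (intro sigma_sets.Basic UN_I [of "Inr j"]) (auto simp: coord_sources_def)
  show ?thesis
    unfolding switch_pair_eq_UN
    by (intro S.countable_nat_UN image_subsetI S.sets_Collect_conj X N)
qed

text \<open>With no jump, of probability \<open>exp (- t)\<close>, the two signs coincide; after any
  jump they are independent. So their correlation is \<open>exp (- t)\<close>.\<close>

lemma prob_switch_pair:
  assumes j: "j \<ge> 1" and t: "t > 0" and ab: "a \<in> {-1, 1}" "b \<in> {-1, 1}"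
  shows "prob {\<omega> \<in> space M. X j 0 \<omega> = a \<and> X j (N j t \<omega>) \<omega> = b} = (1 + exp (- t) * a * b) / 4"
proof -
  let ?E = "\<lambda>i. {\<omega> \<in> space M. X j 0 \<omega> = a \<and> N j t \<omega> = i \<and> X j i \<omega> = b}"
  let ?q = "\<lambda>i. pmf (poisson_pmf t) i"
  have X: "{\<omega> \<in> space M. X j i \<omega> = c} \<in> events" for i c
    using measurable_sets [OF X_meas [OF j], of "{c}" i] by (simp add: vimage_def Int_def conj_commute)
  have N: "{\<omega> \<in> space M. N j t \<omega> = i} \<in> events" for i
    using measurable_sets [OF N_meas [OF j], of t "{i}"] t by (simp add: vimage_def Int_def conj_commute)
  have sums: "(\<lambda>i. prob (?E i)) sums prob (\<Union>i. ?E i)"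
    by (intro finite_measure_UNION image_subsetI sets.sets_Collect_conj X N)
       (auto simp: disjoint_family_on_def)
  have q: "?q sums 1"
    using sums_infsetsum_nat [OF pmf_abs_summable [of "poisson_pmf t" UNIV]]
    by (simp add: infsetsum_pmf_eq_1)
  \<comment> \<open>Every term is taken as if the signs were independent, and the term
    \<open>i = 0\<close> is then corrected.\<close>
  have "(\<lambda>i. ?q i / 4 + (if i = 0 then (of_bool (a = b) / 2 - 1 / 4) * ?q 0 else 0))
      sums (1 / 4 + (of_bool (a = b) / 2 - 1 / 4) * ?q 0)"
    by (intro sums_add sums_divide q sums_single)
  also have "(\<lambda>i. ?q i / 4 + (if i = 0 then (of_bool (a = b) / 2 - 1 / 4) * ?q 0 else 0)) = (\<lambda>i. prob (?E i))"
    by (auto simp: fun_eq_iff prob_switch_pair_given_jumps [OF assms] algebra_simps)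
  finally have "prob (\<Union>i. ?E i) = 1 / 4 + (of_bool (a = b) / 2 - 1 / 4) * ?q 0"
    using sums sums_unique2 by blast
  also have "\<dots> = (1 + exp (- t) * a * b) / 4"
    using ab t by (auto simp: pmf_poisson field_simps)
  finally show ?thesis unfolding switch_pair_eq_UN .
qed

lemma prob_switch_pairs:
  assumes n: "n \<ge> 1" and t: "t > 0" and a: "a \<in> signs n" and b: "b \<in> signs n"
  shows "prob {\<omega> \<in> space M. \<forall>j\<in>{1..n}. X j 0 \<omega> = a j \<and> X j (N j t \<omega>) \<omega> = b j}
       = (\<Prod>j=1..n. (1 + exp (- t) * a j * b j) / 4)"
proof -
  let ?E = "\<lambda>j. {\<omega> \<in> space M. X j 0 \<omega> = a j \<and> X j (N j t \<omega>) \<omega> = b j}"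
  have ind: "indep_sets (\<lambda>j. sigma_sets (space M) (\<Union>k\<in>coord_sources j. source_events k)) {1..}"
    by (rule indep_sets_collect_sigma [OF indep_source_events Int_stable_source_events])
       (auto simp: disjoint_family_on_def coord_sources_def)
  have "{\<omega> \<in> space M. \<forall>j\<in>{1..n}. X j 0 \<omega> = a j \<and> X j (N j t \<omega>) \<omega> = b j} = (\<Inter>j\<in>{1..n}. ?E j)"
    using n by auto
  also have "prob \<dots> = (\<Prod>j=1..n. prob (?E j))"
    by (rule indep_setsD [OF ind]) (use n t in \<open>auto intro!: switch_pair_event\<close>)
  also have "\<dots> = (\<Prod>j=1..n. (1 + exp (- t) * a j * b j) / 4)"
  proof (rule prod.cong [OF refl])
    fix j assume j: "j \<in> {1..n}"
    then show "prob (?E j) = (1 + exp (- t) * a j * b j) / 4"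
      using signsD [OF a j] signsD [OF b j] t by (intro prob_switch_pair) auto
  qed
  finally show ?thesis .
qed

end

section \<open>Quantitative bound for the walk and passage to the limit\<close>

context switch_environment
begin

lemma prob_switch_walk:
  assumes n: "n \<ge> 1" and t: "t > 0"
  shows "prob {\<omega> \<in> space M. \<Phi> (switch_walk X N n 0 \<omega>) (switch_walk X N n t \<omega>)}
       = (\<Sum>s\<in>signs n. bias_weight (exp (- t)) n s *
            freq n (\<lambda>x. \<Phi> (\<Sum>k=1..n. x k) (\<Sum>k=1..n. x k * (\<Prod>j=1..k. s j))))"
proof -
  let ?\<sigma> = "\<lambda>j. X j 0" and ?\<tau> = "\<lambda>j \<omega>. X j (N j t \<omega>) \<omega>"
  have "switch_walk X N n 0 \<omega> = (\<Sum>k=1..n. \<Prod>j=1..k. ?\<sigma> j \<omega>)" if "\<omega> \<in> space M" for \<omega>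
    unfolding switch_walk_def dyn_X_def using that by (intro sum.cong prod.cong) (auto simp: N_0)
  moreover have "switch_walk X N n t \<omega> = (\<Sum>k=1..n. \<Prod>j=1..k. ?\<tau> j \<omega>)" for \<omega>
    by (simp add: switch_walk_def dyn_X_def)
  ultimately have "{\<omega> \<in> space M. \<Phi> (switch_walk X N n 0 \<omega>) (switch_walk X N n t \<omega>)}
      = {\<omega> \<in> space M. \<Phi> (\<Sum>k=1..n. \<Prod>j=1..k. ?\<sigma> j \<omega>) (\<Sum>k=1..n. \<Prod>j=1..k. ?\<tau> j \<omega>)}"
    by (intro Collect_cong conj_cong refl) simp
  moreover have "?\<tau> j \<in> measurable M (count_space UNIV)" if "j \<in> {1..n}" for j
    using that t by (intro measurable_compose_countable [of "X j" M _ "N j t"] X_meas N_meas) auto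
  ultimately show ?thesis
    using prob_sign_pairs [of n ?\<sigma> ?\<tau> "exp (- t)" \<Phi>] X_meas prob_switch_pairs [OF n t] by simp
qed

text \<open>For \<open>t\<close> in (0, 1) one has \<open>1 - exp (- t) \<ge> t / 2\<close>, so the
  condition on \<open>4 / t\<close> implies the one on \<open>2 / (1 - \<rho>)\<close> in
  \<open>joint_positive_average\<close>.\<close>

lemma switch_walk_positive_correlation:
  assumes n: "n \<ge> 1" and t: "0 < t" "t < 1" and v: "v > 0" "4 / t \<le> n * v ^ 8"
  shows "\<bar>prob {\<omega> \<in> space M. switch_walk X N n 0 \<omega> > 0 \<and> switch_walk X N n t \<omega> > 0}
            - (prob {\<omega> \<in> space M. switch_walk X N n 0 \<omega> > 0})\<^sup>2\<bar>
         \<le> 4 * v + v\<^sup>2 + 8 / sqrt (real n + 1)"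
proof -
  let ?\<rho> = "exp (- t)"
  have "?\<rho> * (1 + t) \<le> ?\<rho> * exp t" by (intro mult_left_mono exp_ge_add_one_self) simp
  then have "?\<rho> \<le> 1 / (1 + t)" using t by (simp add: exp_minus field_simps)
  also have "\<dots> \<le> 1 - t / 2"
  proof -
    have "t * t \<le> t * 1" using t by (intro mult_left_mono) auto
    then show ?thesis using t by (simp add: field_simps)
  qed
  finally have \<rho>: "t / 2 \<le> 1 - ?\<rho>" by simp
  then have "2 / (1 - ?\<rho>) \<le> 2 / (t / 2)" using t by (intro divide_left_mono mult_pos_pos) auto
  then have v': "2 / (1 - ?\<rho>) \<le> n * v ^ 8" using v by simp
  \<comment> \<open>The event ignores the second walk, so the biased weights sum out to 1.\<close>
  have "prob {\<omega> \<in> space M. switch_walk X N n 0 \<omega> > 0} = freq n (\<lambda>x. 0 < (\<Sum>k=1..n. x k))"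
    using prob_switch_walk [OF n t(1), of "\<lambda>u _. u > 0"]
    by (simp add: sum_bias_weight flip: sum_distrib_right)
  moreover have "prob {\<omega> \<in> space M. switch_walk X N n 0 \<omega> > 0 \<and> switch_walk X N n t \<omega> > 0}
      = (\<Sum>s\<in>signs n. bias_weight ?\<rho> n s * joint_positive n (\<lambda>k. \<Prod>j=1..k. s j))"
    using prob_switch_walk [OF n t(1), of "\<lambda>u v. u > 0 \<and> v > 0"] by (simp add: joint_positive_def)
  ultimately show ?thesis
    using joint_positive_average [OF _ _ n v(1) v'] t by simp
qed

end

theorem theorem2:
  fixes M :: "'a measure"
    and X :: "nat \<Rightarrow> nat \<Rightarrow> 'a \<Rightarrow> int"
    and N :: "nat \<Rightarrow> real \<Rightarrow> 'a \<Rightarrow> nat"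
    and eps :: "nat \<Rightarrow> real"
  assumes M: "prob_space M"
    and X_distr: "\<And>j i. j \<ge> 1 \<Longrightarrow>
       distr M (count_space UNIV) (X j i) = measure_pmf (pmf_of_set {-1, 1})"
    and X_meas: "\<And>j i. j \<ge> 1 \<Longrightarrow> X j i \<in> measurable M (count_space UNIV)"
    and N_pp: "\<And>j. j \<ge> 1 \<Longrightarrow> poisson_process M (N j)"
    and indep: "prob_space.indep_sets M
       (\<lambda>k. case k of
           Inl (j, i) \<Rightarrow> sigma_sets (space M) {X j i -` A \<inter> space M | A. True}
         | Inr j \<Rightarrow> sigma_sets (space M) {N j t -` A \<inter> space M | t A. t \<ge> 0})
       (Inl ` {(j, i). j \<ge> 1} \<union> Inr ` {j. j \<ge> 1})"
    and eps_range: "\<And>n. n \<ge> 1 \<Longrightarrow> 0 < eps n \<and> eps n < 1"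
    and eps_lim: "filterlim (\<lambda>n. real n * eps n) at_top sequentially"
  shows "(\<lambda>n. measure M {\<omega> \<in> space M. switch_walk X N n 0 \<omega> > 0 \<and> switch_walk X N n (eps n) \<omega> > 0}
              - (measure M {\<omega> \<in> space M. switch_walk X N n 0 \<omega> > 0})\<^sup>2) \<longlonglongrightarrow> 0"
proof -
  interpret switch_environment M X N
    by (intro switch_environment.intro switch_environment_axioms.intro M X_distr X_meas N_pp indep)
  \<comment> \<open>Chosen so that \<open>n * v n ^ 8\<close> equals \<open>4 / eps n\<close>; it
    tends to 0 exactly because \<open>n * eps n\<close> tends to infinity.\<close>
  define v where "v n = (4 / (real n * eps n)) powr (1 / 8)" for n
  let ?d = "\<lambda>n. measure M {\<omega> \<in> space M. switch_walk X N n 0 \<omega> > 0 \<and> switch_walk X N n (eps n) \<omega> > 0}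
              - (measure M {\<omega> \<in> space M. switch_walk X N n 0 \<omega> > 0})\<^sup>2"
  have bound: "norm (?d n) \<le> 4 * v n + (v n)\<^sup>2 + 8 / sqrt (real n + 1)" if n: "n \<ge> 1" for n
  proof -
    have e: "0 < eps n" "eps n < 1" using eps_range n by auto
    then have "(v n) ^ 8 = 4 / (real n * eps n)"
      using n by (simp add: v_def powr_power)
    then have "4 / eps n \<le> n * (v n) ^ 8" using n e by simp
    moreover have "v n > 0" using n e by (simp add: v_def)
    ultimately show ?thesis using switch_walk_positive_correlation [OF n e] by simp
  qed
  have "(\<lambda>n. 4 / (real n * eps n)) \<longlonglongrightarrow> 0"
    by (rule real_tendsto_divide_at_top [OF tendsto_const eps_lim])
  \<comment> \<open>At the boundary point 0, continuity of \<open>powr\<close> rests on the positive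
    exponent and an eventually nonnegative base.\<close>
  then have "(\<lambda>n. (4 / (real n * eps n)) powr (1 / 8)) \<longlonglongrightarrow> 0 powr (1 / 8)"
  proof (rule tendsto_powr2 [OF _ tendsto_const])
    show "\<forall>\<^sub>F n in sequentially. 0 \<le> 4 / (real n * eps n)"
      using eventually_ge_at_top [of 1] by eventually_elim (use eps_range in \<open>auto intro!: divide_nonneg_nonneg simp: less_imp_le\<close>)
  qed simp
  then have "v \<longlonglongrightarrow> 0" by (simp add: v_def [abs_def])
  moreover have "(\<lambda>n. 8 / sqrt (real n + 1)) \<longlonglongrightarrow> 0"
  proof (rule real_tendsto_divide_at_top [OF tendsto_const filterlim_compose [OF sqrt_at_top]])
    show "filterlim (\<lambda>n. real n + 1) at_top sequentially"
      by (rule filterlim_at_top_mono [OF filterlim_real_sequentially]) simp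
  qed
  ultimately have "(\<lambda>n. 4 * v n + (v n)\<^sup>2 + 8 / sqrt (real n + 1)) \<longlonglongrightarrow> 4 * 0 + 0\<^sup>2 + 0"
    by (intro tendsto_intros)
  then have "(\<lambda>n. 4 * v n + (v n)\<^sup>2 + 8 / sqrt (real n + 1)) \<longlonglongrightarrow> 0" by simp
  then show ?thesis
    by (rule Lim_null_comparison [rotated])
       (use eventually_ge_at_top [of 1] in eventually_elim, rule bound)
qed

end
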